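(* Let $k\geq 3$ be an integer. For $n\geq 1$ let $T_k(n)$ denote the $n$-th Hecke operator acting on the space $S_k$ of holomorphic cusp forms of weight $k$ for $SL_2(\mathbb{Z})$, normalized so that its eigenvalues are $n^{-(k-1)/2}$ times the classical Hecke eigenvalues (so that the Ramanujan conjecture reads $\operatorname{tr}(T_k(n))=O_{k,\epsilon}(n^{\epsilon})$). Then for every $\epsilon>0$, \[\sum_{n<X}\operatorname{tr}(T_k(n))=O_{k,\epsilon}\bigl(X^{\frac{31}{32}+\epsilon}\bigr)\] as $X\to\infty$.
   Context: The classical Hecke operator $T_n$ on weight $k$ cusp forms of full level has eigenvalues of size $n^{(k-1)/2+\epsilon}$; here $T_k(n)=n^{-(k-1)/2}T_n$. *)

theory Defs
  imports
    "HOL-Complex_Analysis.Complex_Analysis"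
    "HOL-Library.Function_Algebras"
    "HOL-Library.Landau_Symbols"
begin

locale vector_space_with_trace = vector_space
begin

definition is_basis_of :: "'b set \<Rightarrow> 'b set \<Rightarrow> bool"
  where "is_basis_of B S \<longleftrightarrow> B \<subseteq> S \<and> independent B \<and> S \<subseteq> span B"

text \<open>
  The trace of \<open>T\<close> on a finite-dimensional \<open>T\<close>-invariant subspace \<open>S\<close>: the sum of the
  diagonal entries of the matrix of \<open>T\<close> with respect to some basis of \<open>S\<close>. The lemma
  \<open>trace_on_eq\<close> below shows that the choice of basis is irrelevant.
\<close>

definition trace_on :: "'b set \<Rightarrow> ('b \<Rightarrow> 'b) \<Rightarrow> 'a"
  where "trace_on S T =
    (let B = (SOME B. is_basis_of B S) in \<Sum>b\<in>B. representation B (T b) b)"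

lemma trace_basis_independent:
  assumes T: "module_hom scale scale T" and TS: "T ` S \<subseteq> S"
    and B: "is_basis_of B S" "finite B" and C: "is_basis_of C S" "finite C"
  shows "(\<Sum>b\<in>B. representation B (T b) b) = (\<Sum>c\<in>C. representation C (T c) c)"
proof -
  interpret T: module_hom scale scale T by fact
  have iB: "independent B" and BS: "B \<subseteq> S" and SB: "S \<subseteq> span B"
    and iC: "independent C" and CS: "C \<subseteq> S" and SC: "S \<subseteq> span C"
    using B C by (auto simp: is_basis_of_def)
  let ?rB = "representation B" and ?rC = "representation C"
  have change: "(\<Sum>b\<in>B. ?rB v b * ?rC b c) = ?rC v c" if "v \<in> S" for v c
  proof -
    have "?rC v c = ?rC (\<Sum>b\<in>B. scale (?rB v b) b) c"
      using sum_representation_eq[OF iB, of v B] that SB B by auto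
    also have "\<dots> = (\<Sum>b\<in>B. ?rC (scale (?rB v b) b) c)"
      using BS SC by (subst representation_sum[OF iC]) (auto intro!: span_scale)
    also have "\<dots> = (\<Sum>b\<in>B. ?rB v b * ?rC b c)"
      using BS SC by (intro sum.cong refl) (auto simp: representation_scale[OF iC])
    finally show ?thesis ..
  qed
  have Texp: "?rB (T b) b = (\<Sum>c\<in>C. ?rC b c * ?rB (T c) b)" if b: "b \<in> B" for b
  proof -
    have "b = (\<Sum>c\<in>C. scale (?rC b c) c)"
      using sum_representation_eq[OF iC, of b C] b BS SC C by auto
    then have "T b = T (\<Sum>c\<in>C. scale (?rC b c) c)" by simp
    also have "\<dots> = (\<Sum>c\<in>C. scale (?rC b c) (T c))"
      by (simp add: T.sum T.scale)
    finally have "?rB (T b) b = ?rB (\<Sum>c\<in>C. scale (?rC b c) (T c)) b" by simp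
    also have "\<dots> = (\<Sum>c\<in>C. ?rB (scale (?rC b c) (T c)) b)"
      using CS SB TS by (subst representation_sum[OF iB]) (auto intro!: span_scale)
    also have "\<dots> = (\<Sum>c\<in>C. ?rC b c * ?rB (T c) b)"
    proof (intro sum.cong refl)
      fix c assume "c \<in> C"
      then have "T c \<in> span B" using CS SB TS by blast
      then show "?rB (scale (?rC b c) (T c)) b = ?rC b c * ?rB (T c) b"
        by (simp add: representation_scale[OF iB])
    qed
    finally show ?thesis .
  qed
  have "(\<Sum>b\<in>B. ?rB (T b) b) = (\<Sum>b\<in>B. \<Sum>c\<in>C. ?rB (T c) b * ?rC b c)"
    by (intro sum.cong refl) (simp add: Texp mult.commute)
  also have "\<dots> = (\<Sum>c\<in>C. \<Sum>b\<in>B. ?rB (T c) b * ?rC b c)"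
    by (rule sum.swap)
  also have "\<dots> = (\<Sum>c\<in>C. ?rC (T c) c)"
    using CS TS by (intro sum.cong refl change) auto
  finally show ?thesis .
qed

lemma trace_on_eq:
  assumes "module_hom scale scale T" "T ` S \<subseteq> S" "is_basis_of B S" "finite B"
  shows "trace_on S T = (\<Sum>b\<in>B. representation B (T b) b)"
proof -
  define C where "C = (SOME C. is_basis_of C S)"
  have C: "is_basis_of C S"
    unfolding C_def using assms(3) by (rule someI)
  have "C \<subseteq> span B" "independent C"
    using C assms(3) by (auto simp: is_basis_of_def)
  then have "finite C"
    using independent_span_bound[OF assms(4)] by blast
  then show ?thesis
    unfolding trace_on_def C_def[symmetric] Let_def
    using trace_basis_independent assms C by blast
qed

end

definition fun_scale :: "complex \<Rightarrow> (complex \<Rightarrow> complex) \<Rightarrow> complex \<Rightarrow> complex"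
  where "fun_scale c f = (\<lambda>z. c * f z)"

global_interpretation cfun: vector_space_with_trace fun_scale
  by unfold_locales (auto simp: fun_scale_def fun_eq_iff algebra_simps)

definition upper_half_plane :: "complex set"
  where "upper_half_plane = {z. Im z > 0}"

text \<open>
  Functions on the upper half plane are represented by total functions that vanish outside
  it, so that equality of cusp forms is equality of functions. The last condition is the
  Fourier expansion at the only cusp, without constant term.
\<close>

definition cusp_forms :: "nat \<Rightarrow> (complex \<Rightarrow> complex) set"
  where "cusp_forms k = {f.
    f holomorphic_on upper_half_plane \<and>
    (\<forall>z. z \<notin> upper_half_plane \<longrightarrow> f z = 0) \<and>
    (\<forall>(a::int) b c d. a * d - b * c = 1 \<longrightarrow>
      (\<forall>z\<in>upper_half_plane.
        f ((of_int a * z + of_int b) / (of_int c * z + of_int d)) =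
          (of_int c * z + of_int d) ^ k * f z)) \<and>
    (\<exists>\<alpha> :: nat \<Rightarrow> complex. \<alpha> 0 = 0 \<and>
      (\<forall>z\<in>upper_half_plane.
        (\<lambda>n. \<alpha> n * exp (2 * of_real pi * \<i> * of_nat n * z)) sums f z))}"

lemma subspace_cusp_forms: "cfun.subspace (cusp_forms k)"
proof (rule cfun.subspaceI)
  show "0 \<in> cusp_forms k"
    by (auto simp: cusp_forms_def zero_fun_def intro!: exI[of _ "\<lambda>_. 0"])
next
  fix f g assume f: "f \<in> cusp_forms k" and g: "g \<in> cusp_forms k"
  obtain u where u: "u 0 = 0" "\<forall>z\<in>upper_half_plane.
      (\<lambda>n. u n * exp (2 * of_real pi * \<i> * of_nat n * z)) sums f z"
    using f by (auto simp: cusp_forms_def)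
  obtain v where v: "v 0 = 0" "\<forall>z\<in>upper_half_plane.
      (\<lambda>n. v n * exp (2 * of_real pi * \<i> * of_nat n * z)) sums g z"
    using g by (auto simp: cusp_forms_def)
  have "\<forall>z\<in>upper_half_plane.
      (\<lambda>n. (u n + v n) * exp (2 * of_real pi * \<i> * of_nat n * z)) sums (f z + g z)"
    using sums_add u(2) v(2) by (fastforce simp: distrib_right)
  then have "\<exists>w. w 0 = 0 \<and> (\<forall>z\<in>upper_half_plane.
      (\<lambda>n. w n * exp (2 * of_real pi * \<i> * of_nat n * z)) sums (f z + g z))"
    using u(1) v(1) by (intro exI[of _ "\<lambda>n. u n + v n"]) auto
  then show "f + g \<in> cusp_forms k"
    using f g by (auto simp: cusp_forms_def plus_fun_def distrib_left intro!: holomorphic_intros)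
next
  fix c f assume f: "f \<in> cusp_forms k"
  obtain u where u: "u 0 = 0" "\<forall>z\<in>upper_half_plane.
      (\<lambda>n. u n * exp (2 * of_real pi * \<i> * of_nat n * z)) sums f z"
    using f by (auto simp: cusp_forms_def)
  have "\<forall>z\<in>upper_half_plane.
      (\<lambda>n. (c * u n) * exp (2 * of_real pi * \<i> * of_nat n * z)) sums (c * f z)"
    using sums_mult u(2) by (fastforce simp: mult.assoc)
  then have "\<exists>w. w 0 = 0 \<and> (\<forall>z\<in>upper_half_plane.
      (\<lambda>n. w n * exp (2 * of_real pi * \<i> * of_nat n * z)) sums (c * f z))"
    using u(1) by (intro exI[of _ "\<lambda>n. c * u n"]) auto
  then show "fun_scale c f \<in> cusp_forms k"
    using f by (auto simp: cusp_forms_def fun_scale_def intro!: holomorphic_intros)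
qed

text \<open>
  The classical operator
  \<open>T\<^sub>n f(z) = n\<^bsup>k-1\<^esup> \<Sum>\<^bsub>ad=n\<^esub> d\<^bsup>-k\<^esup> \<Sum>\<^bsub>0\<le>b<d\<^esub> f((az+b)/d)\<close>,
  with \<open>a = n/d\<close>.
\<close>

definition classical_hecke :: "nat \<Rightarrow> nat \<Rightarrow> (complex \<Rightarrow> complex) \<Rightarrow> complex \<Rightarrow> complex"
  where "classical_hecke k n f = (\<lambda>z. of_nat n ^ (k - 1) *
    (\<Sum>d | d dvd n. (1 / of_nat d ^ k) *
      (\<Sum>b<d. f ((of_nat (n div d) * z + of_nat b) / of_nat d))))"

definition hecke :: "nat \<Rightarrow> nat \<Rightarrow> (complex \<Rightarrow> complex) \<Rightarrow> complex \<Rightarrow> complex"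
  where "hecke k n f =
    fun_scale (of_real (real n powr (- ((real k - 1) / 2)))) (classical_hecke k n f)"

lemma module_hom_hecke: "module_hom fun_scale fun_scale (hecke k n)"
  by unfold_locales
    (auto simp: hecke_def classical_hecke_def fun_scale_def plus_fun_def fun_eq_iff
      sum.distrib sum_distrib_left algebra_simps)

definition hecke_trace :: "nat \<Rightarrow> nat \<Rightarrow> complex"
  where "hecke_trace k n = cfun.trace_on (cusp_forms k) (hecke k n)"

end

theory Submission
  imports Defs
begin

text \<open>
  Hecke's argument gives the stronger bound \<open>O(X\<^bsup>1/2\<^esup> log X)\<close>. A cusp form satisfies
  \<open>f(z) = O(y\<^bsup>-k/2\<^esup>)\<close>, because \<open>y\<^bsup>k/2\<^esup> |f(z)|\<close> is invariant under the modular group, every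
  orbit meets \<open>y \<ge> 1/5\<close> by Dirichlet approximation, and \<open>f\<close> decays exponentially there.
  Integrating \<open>f(x + i/N)\<close> against the geometric sum of \<open>e(-n(x + i/N))\<close>, \<open>n \<le> N\<close>, whose
  \<open>L\<^sup>1\<close> norm is \<open>O(log N)\<close>, bounds the sum of the first \<open>N\<close> Fourier coefficients by
  \<open>O(N\<^bsup>k/2\<^esup> log N)\<close>. The same holds for the coefficients at multiples of a fixed integer \<open>r\<close>, which
  belong to the average of the translates \<open>f((z + b)/r)\<close>.

  In a finite-dimensional space of cusp forms every coordinate functional is a combination of
  finitely many Fourier coefficients, so the trace of \<open>T\<^sub>n\<close> is a fixed combination of
  coefficients \<open>a\<^sub>m(T\<^sub>n f) = \<Sum>\<^bsub>a | (m,n)\<^esub> a\<^bsup>k-1\<^esup> a\<^bsub>mn/a\<^sup>2\<^esub>(f)\<close> of the basis forms. Summation by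
  parts removes the weight \<open>n\<^bsup>-(k-1)/2\<^esup>\<close>.
\<close>

subsection \<open>Fourier expansions and partial sums of their coefficients\<close>

text \<open>The expansion clause of \<open>cusp_forms\<close> in isolation, with no modularity and
  no condition on the constant term, so that it also covers averages of shifts and dilates of a cusp
  form.\<close>

definition has_qexp :: "(nat \<Rightarrow> complex) \<Rightarrow> (complex \<Rightarrow> complex) \<Rightarrow> bool"
  where "has_qexp \<alpha> f \<longleftrightarrow>
    (\<forall>z\<in>upper_half_plane. (\<lambda>n. \<alpha> n * exp (2 * of_real pi * \<i> * of_nat n * z)) sums f z)"

lemma norm_exp_2pi_i:
  "norm (exp (2 * of_real pi * \<i> * of_nat n * z)) = exp (- (2 * pi * real n * Im z))"
  by (simp add: norm_exp_eq_Re)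

text \<open>In the variable q = e(z) the expansion is a power series. Convergence at height y/2,
  where |q| is larger, forces absolute convergence at height y.\<close>

lemma has_qexp_summable_norm:
  assumes "has_qexp \<alpha> f" "y > 0"
  shows "summable (\<lambda>n. norm (\<alpha> n) * exp (- (2 * pi * real n * y)))"
proof -
  define q where "q t = exp (2 * of_real pi * \<i> * (\<i> * complex_of_real t))" for t
  have q: "exp (2 * of_real pi * \<i> * of_nat n * (\<i> * complex_of_real t)) = q t ^ n" for n t
    unfolding q_def exp_of_nat_mult[symmetric] by (simp add: mult_ac)
  have nq: "norm (q t) = exp (- (2 * pi * t))" for t
    by (simp add: q_def norm_exp_eq_Re)
  have "summable (\<lambda>n. \<alpha> n * q (y / 2) ^ n)"
  proof -
    have "(\<lambda>n. \<alpha> n * q (y / 2) ^ n) sums f (\<i> * complex_of_real (y / 2))"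
      using assms(1)[unfolded has_qexp_def, rule_format, of "\<i> * complex_of_real (y / 2)"] assms(2)
      unfolding q[symmetric] by (simp add: upper_half_plane_def mult_ac)
    then show ?thesis by (rule sums_summable)
  qed
  moreover have "norm (q y) < norm (q (y / 2))"
    using assms by (simp add: nq)
  ultimately have "summable (\<lambda>n. norm (\<alpha> n * q y ^ n))"
    by (rule powser_insidea)
  also have "(\<lambda>n. norm (\<alpha> n * q y ^ n)) = (\<lambda>n. norm (\<alpha> n) * exp (- (2 * pi * real n * y)))"
    by (simp add: norm_mult norm_power nq exp_of_nat_mult[symmetric] mult_ac)
  finally show ?thesis .
qed

lemma has_integral_exp_2pi_int:
  "((\<lambda>x. exp (2 * of_real pi * \<i> * of_int j * of_real x)) has_integral (if j = 0 then 1 else 0)) {0..1}"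
proof (cases "j = 0")
  case True
  then show ?thesis using has_integral_const_real[of "1::complex" 0 1] by simp
next
  case False
  define c where "c = 2 * of_real pi * \<i> * complex_of_int j"
  have c: "c \<noteq> 0" using False by (simp add: c_def)
  have "((\<lambda>x. exp (c * of_real x)) has_integral (exp (c * of_real 1) / c - exp (c * of_real 0) / c)) {0..1}"
  proof (rule fundamental_theorem_of_calculus)
    fix x :: real
    have "((\<lambda>z. exp (c * z) / c) has_field_derivative exp (c * of_real x)) (at (of_real x))"
      using c by (auto intro!: derivative_eq_intros)
    then show "((\<lambda>x. exp (c * of_real x) / c) has_vector_derivative exp (c * of_real x)) (at x within {0..1})"
      using has_vector_derivative_real_field has_vector_derivative_at_within by blast
  qed simp
  moreover have "exp c = 1"
    unfolding exp_eq_1 c_def by (auto intro!: exI[of _ j])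
  ultimately show ?thesis using False by (simp add: c_def)
qed

text \<open>Orthogonality of the exponentials over one period isolates the n-th term. The
  Weierstrass test makes the series converge uniformly in x, which justifies integrating term by
  term.\<close>

lemma has_qexp_coeff_integral:
  assumes "has_qexp \<alpha> f" "y > 0"
  shows "((\<lambda>x. f (Complex x y) * exp (- (2 * of_real pi * \<i> * of_nat n * Complex x y)))
           has_integral \<alpha> n) {0..1}"
proof -
  define g where "g m x = \<alpha> m * exp (2 * of_real pi * \<i> * of_nat m * Complex x y) *
    exp (- (2 * of_real pi * \<i> * of_nat n * Complex x y))" for m x
  define h where "h x = f (Complex x y) * exp (- (2 * of_real pi * \<i> * of_nat n * Complex x y))" for x
  have g_eq: "g m x = (\<alpha> m * exp (- (2 * of_real pi * of_int (int m - int n) * of_real y))) *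
      exp (2 * of_real pi * \<i> * of_int (int m - int n) * of_real x)" for m x
    by (simp add: g_def Complex_eq exp_add[symmetric] mult.assoc algebra_simps)
  have gi: "(g m has_integral (if m = n then \<alpha> n else 0)) {0..1}" for m
  proof -
    have "(g m has_integral (\<alpha> m * exp (- (2 * of_real pi * of_int (int m - int n) * of_real y))) *
       (if int m - int n = 0 then 1 else 0)) {0..1}"
      unfolding g_eq by (intro has_integral_mult_right has_integral_exp_2pi_int)
    then show ?thesis by (cases "m = n") auto
  qed
  have hs: "(\<lambda>m. g m x) sums h x" for x
    unfolding g_def h_def using assms
    by (intro sums_mult2) (auto simp: has_qexp_def upper_half_plane_def)
  have "uniform_limit {0..1} (\<lambda>N x. \<Sum>m<N. g m x) (\<lambda>x. \<Sum>m. g m x) sequentially"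
  proof (rule Weierstrass_m_test)
    show "norm (g m x) \<le> norm (\<alpha> m) * exp (- (2 * pi * real m * y)) * exp (2 * pi * real n * y)" for m x
      by (simp add: g_def norm_mult norm_exp_eq_Re)
    show "summable (\<lambda>m. norm (\<alpha> m) * exp (- (2 * pi * real m * y)) * exp (2 * pi * real n * y))"
      by (intro summable_mult2 has_qexp_summable_norm[OF assms])
  qed
  also have "(\<lambda>x. \<Sum>m. g m x) = h"
    using hs by (auto simp: sums_iff)
  finally have ul: "uniform_limit {0..1} (\<lambda>N x. \<Sum>m<N. g m x) h sequentially" .
  have "((\<lambda>x. \<Sum>m<N. g m x) has_integral (\<Sum>m<N. if m = n then \<alpha> n else 0)) {0..1}" for N
    by (intro has_integral_sum gi) auto
  then have gN: "((\<lambda>x. \<Sum>m<N. g m x) has_integral (if n < N then \<alpha> n else 0)) {0..1}" for N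
    by simp
  have cg: "continuous_on {0..1} (\<lambda>x. \<Sum>m<N. g m x)" for N
    unfolding g_eq by (intro continuous_intros)
  obtain I J where IJ: "\<And>N. ((\<lambda>x. \<Sum>m<N. g m x) has_integral I N) {0..1}"
      "(h has_integral J) {0..1}" "I \<longlonglongrightarrow> J"
    using uniform_limit_integral[OF ul cg] by auto
  have "I = (\<lambda>N. if n < N then \<alpha> n else 0)"
    using IJ(1) gN has_integral_unique by blast
  moreover have "(\<lambda>N. if n < N then \<alpha> n else 0) \<longlonglongrightarrow> \<alpha> n"
    by (rule tendsto_eventually) (use eventually_gt_at_top[of n] in eventually_elim, simp)
  ultimately have "J = \<alpha> n"
    using IJ(3) LIMSEQ_unique by blast
  then show ?thesis using IJ(2) unfolding h_def[abs_def] by simp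
qed

lemma has_qexp_unique:
  assumes "has_qexp \<alpha> f" "has_qexp \<beta> f"
  shows "\<alpha> = \<beta>"
  using has_integral_unique[OF has_qexp_coeff_integral[OF assms(1), of 1]
      has_qexp_coeff_integral[OF assms(2), of 1]] by auto

section \<open>The L1 norm of the geometric kernel\<close>

lemma norm_exp_minus_1_ge:
  assumes "s \<ge> 0" "0 \<le> x" "x \<le> 1 / 2"
  shows "norm (exp (Complex (2 * pi * s) (- (2 * pi * x))) - 1) \<ge> x + s"
proof -
  define E where "E = exp (2 * pi * s)"
  have E: "E - 1 \<ge> 2 * pi * s" "E \<ge> 1" 
    using exp_ge_add_one_self[of "2 * pi * s"] assms by (auto simp: E_def algebra_simps)
  \<comment> \<open>Jordan's inequality, from concavity of the sine on [0, pi/2].\<close>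
  have sn: "sin (pi * x) \<ge> 2 * x"
  proof -
    have "convex_on {0..pi/2} (\<lambda>x. - sin x)"
      by (rule f''_ge0_imp_convex[where f' = "\<lambda>x. - cos x" and f'' = "sin"])
         (auto intro!: derivative_eq_intros sin_ge_zero)
    from convex_onD[OF this, of "2*x" 0 "pi/2"] assms show ?thesis by (simp add: mult_ac)
  qed
  \<comment> \<open>The squared distance splits as (E - 1)^2 + 4 E sin^2(pi x): a radial part
    controlled by s and an angular part controlled by x.\<close>
  have "(norm (exp (Complex (2 * pi * s) (- (2 * pi * x))) - 1))\<^sup>2 = (E * cos (2*(pi*x)) - 1)\<^sup>2 + (E * sin (2*(pi*x)))\<^sup>2"
    by (simp add: cmod_power2 Re_exp Im_exp E_def mult.assoc)
  also have "\<dots> = E\<^sup>2 * ((cos (2*(pi*x)))\<^sup>2 + (sin (2*(pi*x)))\<^sup>2) - 2 * E * cos (2*(pi*x)) + 1"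
    by algebra
  also have "\<dots> = (E - 1)\<^sup>2 + 4 * E * (sin (pi*x))\<^sup>2"
    unfolding sin_cos_squared_add2 unfolding cos_double_sin by (simp add: power2_eq_square algebra_simps)
  also have "\<dots> \<ge> (2 * s)\<^sup>2 + (2*x)\<^sup>2"
  proof (rule add_mono)
    have "2 * s \<le> 2 * pi * s" using assms pi_gt3 by (intro mult_right_mono) auto
    then show "(2 * s)\<^sup>2 \<le> (E - 1)\<^sup>2" using E assms by (intro power_mono) auto
    have "1 * (2*x)\<^sup>2 \<le> (4*E) * (sin (pi*x))\<^sup>2" using E sn assms by (intro mult_mono power_mono) auto
    then show "(2*x)\<^sup>2 \<le> 4*E * (sin (pi*x))\<^sup>2" by simp
  qed
  also have "(2 * s)\<^sup>2 + (2*x)\<^sup>2 \<ge> (x + s)\<^sup>2"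
  proof -
    have "(2 * s)\<^sup>2 + (2 * x)\<^sup>2 = (x + s)\<^sup>2 + ((x - s)\<^sup>2 + 2 * x\<^sup>2 + 2 * s\<^sup>2)"
      by (simp add: power2_eq_square algebra_simps)
    then show ?thesis
      using zero_le_power2[of "x - s"] zero_le_power2[of x] zero_le_power2[of s] by linarith
  qed
  finally show ?thesis by (rule power2_le_imp_le) auto
qed

text \<open>Complex conjugation exchanges x and 1 - x, which reduces the right half of the period to
  the left half. Adding both bounds gives one formula on all of [0, 1] with an elementary
  integral.\<close>

lemma norm_exp_minus_1_inverse_le:
  assumes "s > 0" "0 \<le> x" "x \<le> 1"
  shows "1 / norm (exp (- (2 * of_real pi * \<i> * Complex x s)) - 1) \<le> 1 / (x + s) + 1 / (1 - x + s)"
proof -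
  have eq: "- (2 * of_real pi * \<i> * Complex x s) = Complex (2 * pi * s) (- (2 * pi * x))"
    by (simp add: complex_eq_iff)
  show ?thesis
  proof (cases "x \<le> 1 / 2")
    case True
    have "1 / norm (exp (- (2 * of_real pi * \<i> * Complex x s)) - 1) \<le> 1 / (x + s)"
      unfolding eq using norm_exp_minus_1_ge[of s x] True assms by (intro divide_left_mono mult_pos_pos) auto
    also have "\<dots> \<le> 1 / (x + s) + 1 / (1 - x + s)" using assms by simp
    finally show ?thesis .
  next
    case False
    have "exp (Complex (2 * pi * s) (- (2 * pi * x))) = cnj (exp (Complex (2 * pi * s) (- (2 * pi * (1 - x)))))"
      by (simp add: complex_eq_iff Re_exp Im_exp algebra_simps cos_diff sin_diff)
    then have "norm (exp (Complex (2 * pi * s) (- (2 * pi * x))) - 1) =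
       norm (exp (Complex (2 * pi * s) (- (2 * pi * (1 - x)))) - 1)"
      by (metis complex_cnj_diff complex_cnj_one complex_mod_cnj)
    also have "\<dots> \<ge> (1 - x) + s" using norm_exp_minus_1_ge[of s "1-x"] False assms by auto
    finally have "1 / norm (exp (- (2 * of_real pi * \<i> * Complex x s)) - 1) \<le> 1 / (1 - x + s)"
      unfolding eq using assms by (intro divide_left_mono mult_pos_pos) auto
    also have "\<dots> \<le> 1 / (x + s) + 1 / (1 - x + s)" using assms by simp
    finally show ?thesis .
  qed
qed

lemma has_integral_inverse_kernel:
  fixes s :: real
  assumes "s > 0"
  shows "((\<lambda>x. 1 / (x + s) + 1 / (1 - x + s)) has_integral (2 * (ln (1 + s) - ln s))) {0..1}"
proof -
  have "((\<lambda>x. 1 / (x + s) + 1 / (1 - x + s)) has_integral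
     ((ln (1 + s) - ln (1 - 1 + s)) - (ln (0 + s) - ln (1 - 0 + s)))) {0..1}"
    using assms by (intro fundamental_theorem_of_calculus)
      (auto intro!: derivative_eq_intros simp: has_real_derivative_iff_has_vector_derivative[symmetric])
  then show ?thesis by (simp add: algebra_simps)
qed

lemma qexp_coeff_sum_bound:
  assumes q: "has_qexp \<beta> F"
    and bd: "\<And>z. Im z > 0 \<Longrightarrow> norm (F z) \<le> C * Im z powr (- s)"
  obtains D where "\<And>N. N \<ge> 1 \<Longrightarrow> norm (\<Sum>n=1..N. \<beta> n) \<le> D * (real N powr s * ln (real N + 1))"
proof -
  \<comment> \<open>Collects the bounds for |w| and |w^N - 1| in the closed form of the geometric
    sum; only 1 / |w - 1| is left to integrate.\<close>
  define L where "L = exp (2 * pi) * (exp (2 * pi) + 1)"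
  have C: "C \<ge> 0" using bd[of \<i>] order_trans[OF norm_ge_zero] by fastforce
  have "norm (\<Sum>n=1..N. \<beta> n) \<le> (C * L * 2) * (real N powr s * ln (real N + 1))" if N: "N \<ge> 1" for N
  proof -
    \<comment> \<open>At height 1/N the powers of w up to the N-th stay bounded by e^(2 pi), while
      the hypothesis on F costs exactly N^s.\<close>
    define y where "y = 1 / real N"
    have y: "y > 0" "y \<le> 1" "real N * y = 1" using N by (auto simp: y_def)
    define w where "w x = exp (- (2 * of_real pi * \<i> * Complex x y))" for x
    have w: "exp (- (2 * of_real pi * \<i> * of_nat n * Complex x y)) = w x ^ n" for n x
      unfolding w_def exp_of_nat_mult[symmetric] by (simp add: mult_ac)
    have nw: "norm (w x) = exp (2 * pi * y)" for x by (simp add: w_def norm_exp_eq_Re)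
    have w1: "w x \<noteq> 1" for x using nw[of x] y by (metis exp_eq_one_iff mult_eq_0_iff norm_one pi_neq_zero order_less_irrefl zero_neq_numeral)
    have int: "((\<lambda>x. F (Complex x y) * (\<Sum>n=1..N. w x ^ n)) has_integral (\<Sum>n=1..N. \<beta> n)) {0..1}"
      unfolding sum_distrib_left w[symmetric]
      by (intro has_integral_sum has_qexp_coeff_integral q y) auto
    have geo: "norm (\<Sum>n=1..N. w x ^ n) \<le> L * (1 / (x + y) + 1 / (1 - x + y))" if x: "x \<in> {0..1}" for x
    proof -
      have "(\<Sum>n=1..N. w x ^ n) = w x * (\<Sum>n<N. w x ^ n)"
        unfolding sum_distrib_left by (rule sum.reindex_bij_witness[of _ Suc "\<lambda>n. n - 1"]) (auto simp: power_eq_if)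
      also have "\<dots> = w x * (w x ^ N - 1) / (w x - 1)"
        using w1 by (simp add: geometric_sum)
      finally have "norm (\<Sum>n=1..N. w x ^ n) = norm (w x) * norm (w x ^ N - 1) * (1 / norm (w x - 1))"
        by (simp add: norm_mult norm_divide)
      also have "\<dots> \<le> exp (2 * pi) * (exp (2 * pi) + 1) * (1 / (x + y) + 1 / (1 - x + y))"
      proof (intro mult_mono)
        show "norm (w x) \<le> exp (2 * pi)" using y by (simp add: nw)
        have "norm (w x ^ N - 1) \<le> norm (w x ^ N) + 1" using norm_triangle_ineq4[of "w x ^ N" 1] by simp
        also have "norm (w x ^ N) = exp (2 * pi * (real N * y))"
          by (simp add: norm_power nw exp_of_nat_mult[symmetric] mult_ac)
        finally show "norm (w x ^ N - 1) \<le> exp (2 * pi) + 1" using y by simp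
        show "1 / norm (w x - 1) \<le> 1 / (x + y) + 1 / (1 - x + y)"
          unfolding w_def using x y by (intro norm_exp_minus_1_inverse_le) auto
      qed (use x y in auto)
      finally show ?thesis by (simp add: L_def)
    qed
    have "norm (integral {0..1} (\<lambda>x. F (Complex x y) * (\<Sum>n=1..N. w x ^ n))) \<le>
       integral {0..1} (\<lambda>x. (C * y powr (- s) * L) * (1 / (x + y) + 1 / (1 - x + y)))"
    proof (rule integral_norm_bound_integral)
      show "(\<lambda>x. F (Complex x y) * (\<Sum>n=1..N. w x ^ n)) integrable_on {0..1}"
        using int by blast
      show "(\<lambda>x. C * y powr - s * L * (1 / (x + y) + 1 / (1 - x + y))) integrable_on {0..1}"
        using has_integral_mult_right[OF has_integral_inverse_kernel[OF y(1)]] by blast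
      fix x :: real assume x: "x \<in> {0..1}"
      have "norm (F (Complex x y) * (\<Sum>n=1..N. w x ^ n)) \<le> (C * y powr (- s)) * (L * (1 / (x + y) + 1 / (1 - x + y)))"
        unfolding norm_mult using bd[of "Complex x y"] geo[OF x] y C by (intro mult_mono) auto
      then show "norm (F (Complex x y) * (\<Sum>n=1..N. w x ^ n)) \<le> C * y powr - s * L * (1 / (x + y) + 1 / (1 - x + y))"
        by (simp add: mult.assoc)
    qed
    also have "\<dots> = (C * y powr (- s) * L) * (2 * (ln (1 + y) - ln y))"
      by (rule integral_unique) (intro has_integral_mult_right has_integral_inverse_kernel y)
    also have "ln (1 + y) - ln y = ln (real N + 1)"
    proof -
      \<comment> \<open>The kernel integral thus contributes ln (N + 1), which is positive already
        at N = 1.\<close>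
      have "1 + y = (real N + 1) * y" using y(3) by (simp add: algebra_simps)
      then show ?thesis using y by (simp add: ln_mult)
    qed
    also have "y powr (- s) = real N powr s"
      using N by (simp add: y_def powr_minus_divide powr_divide)
    finally show ?thesis using integral_unique[OF int] by (simp add: mult_ac)
  qed
  then show ?thesis by (rule that)
qed

section \<open>Expansions under averaging, dilation and Hecke operators\<close>

lemma sum_root_of_unity:
  assumes "d > 0"
  shows "(\<Sum>b<d. exp (2 * of_real pi * \<i> * of_nat m * (of_nat b / of_nat d))) =
    (if d dvd m then of_nat d else 0)"
proof -
  define \<zeta> where "\<zeta> = exp (2 * of_real pi * \<i> * of_nat m / of_nat d)"
  have \<zeta>: "exp (2 * of_real pi * \<i> * of_nat m * (of_nat b / of_nat d)) = \<zeta> ^ b" for b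
    unfolding \<zeta>_def exp_of_nat_mult[symmetric] by (simp add: mult_ac)
  have \<zeta>d: "\<zeta> ^ d = 1"
    unfolding \<zeta>_def exp_of_nat_mult[symmetric] using assms
    by (auto simp: exp_eq_1 intro!: exI[of _ "int m"])
  have "\<zeta> = 1 \<longleftrightarrow> d dvd m"
  proof
    assume "\<zeta> = 1"
    then obtain n :: int where "2 * pi * real m / real d = real_of_int (2 * n) * pi"
      unfolding \<zeta>_def exp_eq_1 by auto
    then have "real m = real_of_int (n * int d)"
      using assms by (simp add: field_simps)
    then have "int m = n * int d" by linarith
    then show "d dvd m" by (metis dvd_triv_right int_dvd_int_iff)
  next
    assume "d dvd m"
    then obtain n where "m = d * n" by blast
    then show "\<zeta> = 1" using assms
      by (auto simp: \<zeta>_def exp_eq_1 intro!: exI[of _ "int n"])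
  qed
  then show ?thesis
    unfolding \<zeta> using \<zeta>d by (auto simp: geometric_sum)
qed

text \<open>Averaging over the d shifts annihilates every frequency that d does not divide, since
  the d-th roots of unity sum to zero; the frequency dn at z/d is the frequency n at z.\<close>

lemma has_qexp_average_shifts:
  assumes "has_qexp \<alpha> f" "d > 0"
  shows "has_qexp (\<lambda>n. \<alpha> (d * n)) (\<lambda>z. (\<Sum>b<d. f ((z + of_nat b) / of_nat d)) / of_nat d)"
  unfolding has_qexp_def
proof
  fix z assume z: "z \<in> upper_half_plane"
  define h where "h m = (if d dvd m then \<alpha> m * exp (2 * of_real pi * \<i> * of_nat m * (z / of_nat d)) else 0)" for m
  have "(\<lambda>m. \<Sum>b<d. \<alpha> m * exp (2 * of_real pi * \<i> * of_nat m * ((z + of_nat b) / of_nat d))) sums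
      (\<Sum>b<d. f ((z + of_nat b) / of_nat d))"
    using assms(2) z by (intro sums_sum assms(1)[unfolded has_qexp_def, rule_format])
      (auto simp: upper_half_plane_def)
  also have "(\<lambda>m. \<Sum>b<d. \<alpha> m * exp (2 * of_real pi * \<i> * of_nat m * ((z + of_nat b) / of_nat d))) =
      (\<lambda>m. of_nat d * h m)"
  proof
    fix m
    have "(\<Sum>b<d. \<alpha> m * exp (2 * of_real pi * \<i> * of_nat m * ((z + of_nat b) / of_nat d))) =
       \<alpha> m * exp (2 * of_real pi * \<i> * of_nat m * (z / of_nat d)) *
       (\<Sum>b<d. exp (2 * of_real pi * \<i> * of_nat m * (of_nat b / of_nat d)))"
      by (simp add: sum_distrib_left add_divide_distrib ring_distribs exp_add mult.assoc)
    then show "(\<Sum>b<d. \<alpha> m * exp (2 * of_real pi * \<i> * of_nat m * ((z + of_nat b) / of_nat d))) = of_nat d * h m"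
      unfolding sum_root_of_unity[OF assms(2)] h_def by simp
  qed
  finally have "(\<lambda>m. of_nat d * h m / of_nat d) sums ((\<Sum>b<d. f ((z + of_nat b) / of_nat d)) / of_nat d)"
    by (rule sums_divide)
  then have "h sums ((\<Sum>b<d. f ((z + of_nat b) / of_nat d)) / of_nat d)"
    using assms by simp
  \<comment> \<open>\<open>h\<close> vanishes off the multiples of d, so its series may be reindexed
    along them.\<close>
  moreover have "strict_mono (\<lambda>n. d * n)"
    using assms by (auto simp: strict_mono_def)
  ultimately have "(\<lambda>n. h (d * n)) sums ((\<Sum>b<d. f ((z + of_nat b) / of_nat d)) / of_nat d)"
    by (subst sums_mono_reindex) (auto simp: h_def dvd_def)
  then show "(\<lambda>n. \<alpha> (d * n) * exp (2 * of_real pi * \<i> * of_nat n * z)) sums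
      ((\<Sum>b<d. f ((z + of_nat b) / of_nat d)) / of_nat d)"
    using assms by (simp add: h_def mult_ac)
qed

lemma has_qexp_dilate:
  assumes "has_qexp \<beta> g" "a > 0"
  shows "has_qexp (\<lambda>n. if a dvd n then \<beta> (n div a) else 0) (\<lambda>z. g (of_nat a * z))"
  unfolding has_qexp_def
proof
  fix z assume z: "z \<in> upper_half_plane"
  define h where "h n = (if a dvd n then \<beta> (n div a) else 0) * exp (2 * of_real pi * \<i> * of_nat n * z)" for n
  have "(\<lambda>n. \<beta> n * exp (2 * of_real pi * \<i> * of_nat n * (of_nat a * z))) sums g (of_nat a * z)"
    using assms z by (auto simp: has_qexp_def upper_half_plane_def)
  also have "(\<lambda>n. \<beta> n * exp (2 * of_real pi * \<i> * of_nat n * (of_nat a * z))) = (\<lambda>n. h (a * n))"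
    using assms by (simp add: h_def mult_ac)
  finally have "h sums g (of_nat a * z)"
    using assms by (subst (asm) sums_mono_reindex) (auto simp: strict_mono_def h_def dvd_def)
  then show "(\<lambda>n. (if a dvd n then \<beta> (n div a) else 0) * exp (2 * of_real pi * \<i> * of_nat n * z)) sums g (of_nat a * z)"
    unfolding h_def[abs_def] .
qed

lemma has_qexp_cmult: "has_qexp \<alpha> f \<Longrightarrow> has_qexp (\<lambda>n. c * \<alpha> n) (\<lambda>z. c * f z)"
  unfolding has_qexp_def by (simp add: mult.assoc sums_mult)

lemma has_qexp_sum:
  "(\<And>i. i \<in> I \<Longrightarrow> has_qexp (\<alpha> i) (f i)) \<Longrightarrow> has_qexp (\<lambda>n. \<Sum>i\<in>I. \<alpha> i n) (\<lambda>z. \<Sum>i\<in>I. f i z)"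
  unfolding has_qexp_def by (auto simp: sum_distrib_right intro!: sums_sum)

text \<open>The form in which the divisor sum of \<open>classical_hecke\<close> yields the
  coefficients: the factor d undoes the normalization of the average over d shifts.
  \<open>hecke_coeff_eq\<close> rewrites it as the classical sum over common divisors.\<close>

definition hecke_coeff :: "nat \<Rightarrow> nat \<Rightarrow> (nat \<Rightarrow> complex) \<Rightarrow> nat \<Rightarrow> complex"
  where "hecke_coeff k n \<alpha> m = (\<Sum>d | d dvd n. of_nat n ^ (k - 1) * of_nat d / of_nat d ^ k *
    (if n div d dvd m then \<alpha> (d * (m div (n div d))) else 0))"

lemma has_qexp_classical_hecke:
  assumes "has_qexp \<alpha> f" "n > 0"
  shows "has_qexp (hecke_coeff k n \<alpha>) (classical_hecke k n f)"
proof -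
  have "has_qexp (\<lambda>m. \<Sum>d | d dvd n. of_nat n ^ (k - 1) * of_nat d / of_nat d ^ k *
    (if n div d dvd m then \<alpha> (d * (m div (n div d))) else 0))
    (\<lambda>z. \<Sum>d | d dvd n. of_nat n ^ (k - 1) * of_nat d / of_nat d ^ k *
      ((\<Sum>b<d. f ((of_nat (n div d) * z + of_nat b) / of_nat d)) / of_nat d))"
  proof (intro has_qexp_sum has_qexp_cmult)
    fix d assume "d \<in> {d. d dvd n}"
    then have d: "d dvd n" "d > 0" "n div d > 0" using assms
      by (auto intro: dvd_pos_nat simp: div_greater_zero_iff dvd_imp_le)
    show "has_qexp (\<lambda>m. if n div d dvd m then \<alpha> (d * (m div (n div d))) else 0)
      (\<lambda>z. (\<Sum>b<d. f ((of_nat (n div d) * z + of_nat b) / of_nat d)) / of_nat d)"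
      using has_qexp_dilate[OF has_qexp_average_shifts[OF assms(1) d(2)] d(3)] .
  qed
  also have "(\<lambda>z. \<Sum>d | d dvd n. of_nat n ^ (k - 1) * of_nat d / of_nat d ^ k *
      ((\<Sum>b<d. f ((of_nat (n div d) * z + of_nat b) / of_nat d)) / of_nat d)) = classical_hecke k n f"
    unfolding classical_hecke_def sum_distrib_left[of "of_nat n ^ (k - 1)"]
    using assms by (intro ext sum.cong refl) (auto simp: field_simps intro: dvd_pos_nat)
  finally show ?thesis
    unfolding hecke_coeff_def[abs_def] .
qed

subsection \<open>Growth of cusp forms\<close>

lemma moebius_Im:
  fixes a b c d :: int
  assumes "Im z > 0" "a * d - b * c > 0"
  shows "of_int c * z + of_int d \<noteq> 0"
    and "Im ((of_int a * z + of_int b) / (of_int c * z + of_int d)) =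
      of_int (a * d - b * c) * Im z / (norm (of_int c * z + of_int d))\<^sup>2"
proof -
  show "of_int c * z + of_int d \<noteq> 0"
  proof
    assume *: "of_int c * z + of_int d = 0"
    from arg_cong[OF this, of Im] have "c = 0" using assms by simp
    with * have "d = 0" by simp
    with \<open>c = 0\<close> assms show False by simp
  qed
  show "Im ((of_int a * z + of_int b) / (of_int c * z + of_int d)) =
      of_int (a * d - b * c) * Im z / (norm (of_int c * z + of_int d))\<^sup>2"
    by (simp add: Im_divide cmod_power2 algebra_simps)
qed

text \<open>The height of the image depends only on the bottom row (c, d), so it suffices to find a
  coprime row with |cz + d|^2 at most 5 Im z. This takes the place of a fundamental domain.\<close>

lemma exists_moebius_Im_ge:
  assumes z: "Im z > 0"
  shows "\<exists>a b c d :: int. a * d - b * c = 1 \<and>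
    Im ((of_int a * z + of_int b) / (of_int c * z + of_int d)) \<ge> 1 / 5"
proof (cases "Im z \<ge> 1")
  case True
  then show ?thesis by (intro exI[of _ 1] exI[of _ 0]) auto
next
  case False
  define y where "y = Im z"
  have y: "y > 0" "y < 1" using z False by (auto simp: y_def)
  \<comment> \<open>A denominator bound of size y^(-1/2) balances the two parts of |cz + d|^2: the
    approximation error contributes at most y and the imaginary part at most 4y.\<close>
  define N where "N = nat \<lceil>1 / sqrt y\<rceil>"
  have sy: "1 / sqrt y > 1" using y by simp
  have N1: "1 / sqrt y \<le> real N" "real N \<le> 2 / sqrt y"
    unfolding N_def using sy by linarith+
  have N0: "N > 0" using N1(1) sy by linarith
  obtain h c where hc: "coprime h c" "0 < c" "c \<le> int N" "\<bar>of_int c * Re z - of_int h\<bar> < 1 / N"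
    using Dirichlet_approx_coprime[OF N0] by metis
  define d where "d = - h"
  have "coprime c d" using hc(1) by (simp add: d_def coprime_commute)
  \<comment> \<open>Bezout completes the coprime row (c, d) to a determinant one matrix with top row
    (v, -u).\<close>
  then obtain u v where uv: "u * c + v * d = 1"
    using bezout_int[of c d] by auto
  have det: "v * d - (- u) * c = 1" using uv by simp
  have "(norm (of_int c * z + of_int d))\<^sup>2 = (of_int c * Re z - of_int h)\<^sup>2 + (of_int c)\<^sup>2 * y\<^sup>2"
    by (simp add: cmod_power2 d_def y_def power_mult_distrib)
  also have "\<dots> \<le> y + 4 * y"
  proof (rule add_mono)
    have "1 / real N \<le> sqrt y" using N1(1) N0 y by (simp add: field_simps)
    then have "\<bar>of_int c * Re z - of_int h\<bar> \<le> sqrt y" using hc(4) by linarith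
    then have "\<bar>of_int c * Re z - of_int h\<bar>\<^sup>2 \<le> (sqrt y)\<^sup>2" by (intro power_mono) auto
    then show "(of_int c * Re z - of_int h)\<^sup>2 \<le> y" using y by simp
    have "real_of_int c \<le> 2 / sqrt y" using hc(3) N1(2) by linarith
    then have "(real_of_int c)\<^sup>2 \<le> (2 / sqrt y)\<^sup>2" using hc(2) by (intro power_mono) auto
    also have "\<dots> = 4 / y" using y by (simp add: power_divide)
    finally have "(real_of_int c)\<^sup>2 * y\<^sup>2 \<le> 4 / y * y\<^sup>2" by (intro mult_right_mono) auto
    also have "\<dots> = 4 * y" using y by (simp add: power2_eq_square)
    finally show "(real_of_int c)\<^sup>2 * y\<^sup>2 \<le> 4 * y" .
  qed
  finally have nb: "(norm (of_int c * z + of_int d))\<^sup>2 \<le> 5 * y" by simp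
  have nz: "of_int c * z + of_int d \<noteq> 0"
    using moebius_Im(1)[OF z, of v d "-u" c] det by simp
  have "Im ((of_int v * z + of_int (- u)) / (of_int c * z + of_int d)) =
      y / (norm (of_int c * z + of_int d))\<^sup>2"
    using moebius_Im(2)[OF z, of v d "-u" c] unfolding det by (simp add: y_def)
  also have "\<dots> \<ge> 1 / 5"
    using nb nz by (simp add: field_simps)
  finally show ?thesis using det by blast
qed

lemma powr_le_exp:
  fixes s y :: real
  assumes "s > 0" "y > 0"
  shows "y powr s \<le> s powr s * exp y"
proof -
  have "y / s \<le> exp (y / s)" using exp_ge_add_one_self[of "y / s"] by linarith
  then have "(y / s) powr s \<le> exp (y / s) powr s" using assms by (intro powr_mono2) auto
  then show ?thesis using assms by (simp add: powr_divide exp_powr_real field_simps)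
qed

lemma cusp_form_qexp:
  assumes "f \<in> cusp_forms k"
  obtains \<alpha> where "\<alpha> 0 = 0" "has_qexp \<alpha> f"
  using assms by (auto simp: cusp_forms_def has_qexp_def)

text \<open>Without a constant term every frequency is at least 1, so raising the height from y0 to
  Im z shrinks each term by at least exp (y0 - Im z).\<close>

lemma qexp_exponential_decay:
  assumes "has_qexp \<alpha> f" "\<alpha> 0 = 0" "y0 > 0"
  obtains S where "\<And>z. Im z \<ge> y0 \<Longrightarrow> norm (f z) \<le> S * exp (- Im z)"
proof -
  define S where "S = (\<Sum>n. norm (\<alpha> n) * exp (- (2 * pi * real n * y0)))"
  have "norm (f z) \<le> (S * exp y0) * exp (- Im z)" if z: "Im z \<ge> y0" for z
  proof -
    have sm: "summable (\<lambda>n. norm (\<alpha> n) * exp (- (2 * pi * real n * y0)))"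
      using has_qexp_summable_norm assms by blast
    have le: "norm (\<alpha> n * exp (2 * of_real pi * \<i> * of_nat n * z)) \<le>
       norm (\<alpha> n) * exp (- (2 * pi * real n * y0)) * exp (y0 - Im z)" for n
    proof (cases "n = 0")
      case True then show ?thesis using assms by simp
    next
      case False
      have "1 * 1 \<le> (2 * pi) * real n" using False pi_gt3 by (intro mult_mono) auto
      then have "1 * (Im z - y0) \<le> (2 * pi * real n) * (Im z - y0)" using z by (intro mult_right_mono) auto
      then have "exp (- (2 * pi * real n * Im z)) \<le> exp (- (2 * pi * real n * y0)) * exp (y0 - Im z)"
        by (simp add: exp_add[symmetric] algebra_simps)
      then show ?thesis by (simp add: norm_mult norm_exp_2pi_i mult.assoc mult_left_mono)
    qed
    have "f z = (\<Sum>n. \<alpha> n * exp (2 * of_real pi * \<i> * of_nat n * z))"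
      using assms z by (simp add: has_qexp_def upper_half_plane_def sums_iff)
    also have "norm \<dots> \<le> (\<Sum>n. norm (\<alpha> n) * exp (- (2 * pi * real n * y0)) * exp (y0 - Im z))"
      by (rule norm_suminf_le[OF le]) (intro summable_mult2 sm)
    also have "\<dots> = S * exp (y0 - Im z)"
      unfolding S_def using sm by (simp add: suminf_mult2)
    finally show ?thesis by (simp add: exp_diff exp_minus field_simps)
  qed
  then show ?thesis by (rule that)
qed

lemma cusp_form_growth:
  assumes f: "f \<in> cusp_forms k" and k: "k \<ge> 1"
  obtains C where "\<And>z. Im z > 0 \<Longrightarrow> norm (f z) \<le> C * Im z powr (- (real k / 2))"
proof -
  obtain \<alpha> where \<alpha>: "\<alpha> 0 = 0" "has_qexp \<alpha> f" using cusp_form_qexp[OF f] .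
  obtain S where S: "\<And>z. Im z \<ge> 1 / 5 \<Longrightarrow> norm (f z) \<le> S * exp (- Im z)"
    using qexp_exponential_decay[OF \<alpha>(2,1), of "1/5"] by auto
  define s where "s = real k / 2"
  have s: "s > 0" using k by (simp add: s_def)
  have S0: "S \<ge> 0" using S[of \<i>] order_trans[OF norm_ge_zero] by (fastforce simp: zero_le_mult_iff)
  have "norm (f z) \<le> (S * s powr s) * Im z powr (- s)" if z: "Im z > 0" for z
  proof -
    obtain a b c d :: int where det: "a * d - b * c = 1"
      and ge: "Im ((of_int a * z + of_int b) / (of_int c * z + of_int d)) \<ge> 1 / 5"
      using exists_moebius_Im_ge[OF z] by blast
    define j where "j = of_int c * z + of_int d"
    define w where "w = (of_int a * z + of_int b) / j"
    have j: "j \<noteq> 0" using moebius_Im(1)[OF z, of a d b c] det by (simp add: j_def)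
    have w: "Im w = Im z / (norm j)\<^sup>2" "Im w \<ge> 1 / 5"
      using moebius_Im(2)[OF z, of a d b c] det ge by (auto simp: j_def w_def)
    have "f w = j ^ k * f z"
      using f det z unfolding cusp_forms_def j_def w_def upper_half_plane_def by blast
    then have "norm (f z) = norm (f w) / norm j ^ k"
      using j by (simp add: norm_mult norm_power)
    also have "norm j ^ k = norm j powr (2 * s)"
      using j by (simp add: s_def powr_realpow)
    also have "\<dots> = (norm j powr 2) powr s"
      by (rule powr_powr[symmetric])
    also have "norm j powr 2 = (norm j)\<^sup>2"
      using j by simp
    \<comment> \<open>This is the invariance of y^(k/2) |f| under the modular group, solved for |f
      z|.\<close>
    also have "norm (f w) / (norm j)\<^sup>2 powr s = norm (f w) * Im w powr s * Im z powr (- s)"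
      using z by (simp add: w(1) powr_divide powr_minus_divide)
    also have "\<dots> \<le> (S * s powr s) * Im z powr (- s)"
    proof (rule mult_right_mono)
      \<comment> \<open>The decay of f at w cancels the exponential in \<open>powr_le_exp\<close>,
        so the bound is uniform in w.\<close>
      have "norm (f w) * Im w powr s \<le> (S * exp (- Im w)) * (s powr s * exp (Im w))"
        using S[OF w(2)] powr_le_exp[OF s, of "Im w"] w(2) S0 by (intro mult_mono) auto
      also have "\<dots> = S * s powr s * (exp (- Im w) * exp (Im w))"
        by (simp only: mult_ac)
      finally show "norm (f w) * Im w powr s \<le> S * s powr s"
        by (simp add: exp_minus)
    qed auto
    finally show ?thesis .
  qed
  then show ?thesis using that s_def by blast
qed

subsection \<open>Hecke operators preserve cusp forms\<close>

type_synonym int_mat2 = "int \<times> int \<times> int \<times> int"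

fun mmul :: "int_mat2 \<Rightarrow> int_mat2 \<Rightarrow> int_mat2" where
  "mmul (a, b, c, d) (a', b', c', d') =
    (a * a' + b * c', a * b' + b * d', c * a' + d * c', c * b' + d * d')"

fun mdet :: "int_mat2 \<Rightarrow> int" where
  "mdet (a, b, c, d) = a * d - b * c"

fun adj :: "int_mat2 \<Rightarrow> int_mat2" where
  "adj (a, b, c, d) = (d, - b, - c, a)"

text \<open>The weight k slash action without the usual power of the determinant: that power is
  constant on matrices of determinant n and is absorbed in the factor in front of
  \<open>classical_hecke\<close>.\<close>

fun slash :: "nat \<Rightarrow> (complex \<Rightarrow> complex) \<Rightarrow> int_mat2 \<Rightarrow> complex \<Rightarrow> complex" where
  "slash k f (a, b, c, d) z =
    f ((of_int a * z + of_int b) / (of_int c * z + of_int d)) / (of_int c * z + of_int d) ^ k"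

text \<open>
  Hermite normal forms, which represent the orbits of \<open>SL\<^sub>2(\<int>)\<close> acting from the left on integer
  matrices of determinant \<open>n\<close>.
\<close>

definition hnf :: "int \<Rightarrow> int_mat2 set" where
  "hnf n = {(a, b, c, d). c = 0 \<and> a * d = n \<and> 0 \<le> b \<and> b < d}"

section \<open>Integer matrices and reduction to Hermite normal form\<close>

lemma mmul_assoc: "mmul (mmul A B) C = mmul A (mmul B C)"
  by (cases A; cases B; cases C) (simp add: algebra_simps)

lemma mdet_mmul: "mdet (mmul A B) = mdet A * mdet B"
  by (cases A; cases B) (simp add: algebra_simps)

lemma mdet_adj: "mdet (adj A) = mdet A"
  by (cases A) (simp add: algebra_simps)

lemma mmul_adj_self:
  "mmul G (adj G) = (mdet G, 0, 0, mdet G)" "mmul (adj G) G = (mdet G, 0, 0, mdet G)"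
  by (cases G; simp add: algebra_simps)+

lemma mmul_one: "mmul (1, 0, 0, 1) M = M" "mmul M (1, 0, 0, 1) = M"
  by (cases M; simp)+

lemma mmul_adj_right: "mdet G = 1 \<Longrightarrow> mmul (mmul M G) (adj G) = M"
  by (simp add: mmul_assoc mmul_adj_self mmul_one)

lemma mmul_adj_left: "mdet G = 1 \<Longrightarrow> mmul (adj G) (mmul G M) = M"
  by (simp add: mmul_assoc[symmetric] mmul_adj_self mmul_one)

lemma finite_hnf:
  assumes "n > 0"
  shows "finite (hnf n)"
proof (rule finite_subset)
  show "hnf n \<subseteq> {1..n} \<times> {0..n} \<times> {0} \<times> {1..n}"
  proof
    fix M assume "M \<in> hnf n"
    then obtain a b d where M: "M = (a, b, 0, d)" "a * d = n" "0 \<le> b" "b < d"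
      by (auto simp: hnf_def)
    have d: "d > 0" using M by simp
    then have a: "a > 0" using M(2) assms zero_less_mult_pos2 by blast
    have "a \<le> n" "d \<le> n" using a d M(2) assms by (auto intro!: zdvd_imp_le)
    then show "M \<in> {1..n} \<times> {0..n} \<times> {0} \<times> {1..n}" using M a d by auto
  qed
qed auto

text \<open>Bezout coefficients of the first column give row operations that turn it into (gcd, 0);
  a multiple of the second row then reduces the upper right entry modulo the lower right
  one.\<close>

lemma exists_hnf:
  assumes "mdet M > 0"
  obtains G where "mdet G = 1" "mmul G M \<in> hnf (mdet M)"
proof -
  obtain a b c d where M: "M = (a, b, c, d)" by (cases M)
  define t where "t = gcd a c"
  have "t \<noteq> 0" using assms by (auto simp: M t_def)
  then have t: "t > 0" by (simp add: t_def)
  obtain u v where uv: "u * a + v * c = t" using bezout_int[of a c] by (auto simp: t_def)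
  obtain a' c' where ac: "a = t * a'" "c = t * c'"
    by (metis t_def gcd_dvd1 gcd_dvd2 dvdE)
  have "t * (u * a' + v * c') = t * 1" using uv by (simp add: ac algebra_simps)
  then have uv': "u * a' + v * c' = 1" using t by (metis mult_cancel_left less_irrefl)
  define D where "D = a' * d - c' * b"
  define B where "B = u * b + v * d"
  have tD: "t * D = mdet M" by (simp add: D_def M ac algebra_simps)
  then have D: "D > 0" using assms t zero_less_mult_pos by metis
  define e where "e = B div D"
  have Bm: "B - e * D = B mod D" by (simp add: e_def minus_div_mult_eq_mod)
  \<comment> \<open>The top row is (u, v) minus e times the bottom row (-c', a').\<close>
  define G where "G = (u + e * c', v - e * a', - c', a')"
  have "mdet G = 1" using uv' by (simp add: G_def algebra_simps)
  moreover have "mmul G M = (t, B mod D, 0, D)"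
    unfolding Bm[symmetric] using uv by (simp add: G_def M D_def B_def ac algebra_simps)
  then have "mmul G M \<in> hnf (mdet M)" using tD D by (simp add: hnf_def)
  ultimately show ?thesis by (rule that)
qed

text \<open>Comparing entries makes G upper triangular with positive diagonal, hence unipotent. It
  then moves b by a multiple of d, and both b and b' are reduced residues modulo d.\<close>

lemma hnf_unique:
  assumes "n > 0" "M \<in> hnf n" "M' \<in> hnf n" "mdet G = 1" "mmul G M = M'"
  shows "M = M'"
proof -
  obtain a b d where M: "M = (a, b, 0, d)" "a * d = n" "0 \<le> b" "b < d"
    using assms by (auto simp: hnf_def)
  obtain a' b' d' where M': "M' = (a', b', 0, d')" "a' * d' = n" "0 \<le> b'" "b' < d'"
    using assms by (auto simp: hnf_def)
  obtain p q r s where G: "G = (p, q, r, s)" by (cases G)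
  have d: "d > 0" "d' > 0" using M M' by auto
  have a: "a > 0" "a' > 0"
    using zero_less_mult_pos2[of a d] zero_less_mult_pos2[of a' d'] M(2) M'(2) assms(1) d by auto
  have eqs: "p * a = a'" "p * b + q * d = b'" "r * a = 0" "r * b + s * d = d'"
    using assms(5) by (auto simp: M M' G)
  have r: "r = 0" using eqs a by simp
  then have "p * s = 1" using assms(4) by (simp add: G)
  moreover have "p > 0" using eqs(1) a zero_less_mult_pos2 by metis
  ultimately have ps: "p = 1" "s = 1" by (auto simp: zmult_eq_1_iff)
  have "b' = b + d * q" using eqs ps by (simp add: mult.commute)
  then have "b' mod d = b mod d" by simp
  then have "b' = b" using M M' eqs r ps by simp
  then show ?thesis using M M' eqs r ps by simp
qed

text \<open>With w = Mz the automorphy factor of the product is i * j, and modularity of f at w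
  cancels i. Hence the slash depends only on the left orbit of M.\<close>

lemma slash_SL2_left:
  assumes f: "f \<in> cusp_forms k" and G: "mdet G = 1" and M: "mdet M > 0" and z: "Im z > 0"
  shows "slash k f (mmul G M) z = slash k f M z"
proof -
  obtain a b c d where Meq: "M = (a, b, c, d)" by (cases M)
  obtain p q r s where Geq: "G = (p, q, r, s)" by (cases G)
  define j where "j = of_int c * z + of_int d"
  define w where "w = (of_int a * z + of_int b) / j"
  define i where "i = of_int r * w + of_int s"
  have j: "j \<noteq> 0" using moebius_Im(1)[OF z, of a d b c] M by (simp add: j_def Meq)
  have w: "Im w > 0"
  proof -
    have "real_of_int (a * d - b * c) > 0" using M by (simp add: Meq del: of_int_diff of_int_mult)
    then show ?thesis
      using moebius_Im(2)[OF z, of a d b c] M z j by (simp add: j_def w_def Meq del: of_int_diff of_int_mult)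
  qed
  have i: "i \<noteq> 0" using moebius_Im(1)[OF w, of p s q r] G by (simp add: i_def Geq)
  have wj: "w * j = of_int a * z + of_int b" using j by (simp add: w_def)
  have "of_int (r * a + s * c) * z + of_int (r * b + s * d) = i * j"
    unfolding i_def ring_distribs mult.assoc wj by (simp add: j_def algebra_simps)
  moreover have "of_int (p * a + q * c) * z + of_int (p * b + q * d) = (of_int p * w + of_int q) * j"
    unfolding ring_distribs mult.assoc wj by (simp add: j_def algebra_simps)
  ultimately have "slash k f (mmul G M) z = f ((of_int p * w + of_int q) / i) / (i * j) ^ k"
    using j by (simp add: Meq Geq del: of_int_add of_int_mult)
  also have "f ((of_int p * w + of_int q) / i) = i ^ k * f w"
    using f G w unfolding cusp_forms_def i_def upper_half_plane_def Geq mdet.simps by blast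
  finally show ?thesis using i j by (simp add: Meq power_mult_distrib w_def j_def)
qed

lemma slash_mmul_right:
  assumes G: "mdet (p, q, r, s) = 1" and z: "Im z > 0"
  shows "slash k f (mmul M (p, q, r, s)) z =
    slash k f M ((of_int p * z + of_int q) / (of_int r * z + of_int s)) / (of_int r * z + of_int s) ^ k"
proof -
  obtain a b c d where Meq: "M = (a, b, c, d)" by (cases M)
  define j where "j = of_int r * z + of_int s"
  define w where "w = (of_int p * z + of_int q) / j"
  have j: "j \<noteq> 0" using moebius_Im(1)[OF z, of p s q r] G by (simp add: j_def)
  have wj: "w * j = of_int p * z + of_int q" using j by (simp add: w_def)
  have "of_int (c * p + d * r) * z + of_int (c * q + d * s) = (of_int c * w + of_int d) * j"
    unfolding ring_distribs mult.assoc wj by (simp add: j_def algebra_simps)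
  moreover have "of_int (a * p + b * r) * z + of_int (a * q + b * s) = (of_int a * w + of_int b) * j"
    unfolding ring_distribs mult.assoc wj by (simp add: j_def algebra_simps)
  ultimately have "slash k f (mmul M (p, q, r, s)) z =
      f ((of_int a * w + of_int b) / (of_int c * w + of_int d)) / ((of_int c * w + of_int d) * j) ^ k"
    using j by (simp add: Meq del: of_int_add of_int_mult)
  then show ?thesis by (simp add: Meq power_mult_distrib w_def j_def)
qed

text \<open>A pair (d, b) of the classical double sum is the triangular matrix with diagonal (n/d,
  d) and corner b, so the operator is a sum over orbit representatives.\<close>

lemma classical_hecke_eq_sum_slash:
  assumes "n > 0"
  shows "classical_hecke k n f z = of_nat n ^ (k - 1) * (\<Sum>M\<in>hnf (int n). slash k f M z)"
proof -
  have "(\<Sum>d | d dvd n. (1 / of_nat d ^ k) * (\<Sum>b<d. f ((of_nat (n div d) * z + of_nat b) / of_nat d))) =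
    (\<Sum>(d, b)\<in>(SIGMA d:{d. d dvd n}. {..<d}). (1 / of_nat d ^ k) * f ((of_nat (n div d) * z + of_nat b) / of_nat d))"
    using assms by (simp add: sum_distrib_left sum.Sigma)
  also have "\<dots> = (\<Sum>M\<in>hnf (int n). slash k f M z)"
  proof (rule sum.reindex_bij_witness[of _ "\<lambda>(a, b, c, d). (nat d, nat b)" "\<lambda>(d, b). (int (n div d), int b, 0, int d)"])
    fix M assume "M \<in> hnf (int n)"
    then obtain a b d where M: "M = (a, b, 0, d)" "a * d = int n" "0 \<le> b" "b < d"
      by (auto simp: hnf_def)
    have d: "d > 0" using M by auto
    have "int (n div nat d) = a" using M(2) d by (simp add: zdiv_int M(2)[symmetric])
    then show "(\<lambda>(d, b). (int (n div d), int b, 0, int d)) ((\<lambda>(a, b, c, d). (nat d, nat b)) M) = M"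
      using M d by simp
    have "nat d dvd n" using M(2) d by (metis dvd_triv_right int_dvd_int_iff int_nat_eq less_imp_le)
    then show "(\<lambda>(a, b, c, d). (nat d, nat b)) M \<in> (SIGMA d:{d. d dvd n}. {..<d})"
      using M d by auto
  next
    fix x assume "x \<in> (SIGMA d:{d. d dvd n}. {..<d})"
    then obtain d b where x: "x = (d, b)" "d dvd n" "b < d" by auto
    show "(\<lambda>(a, b, c, d). (nat d, nat b)) ((\<lambda>(d, b). (int (n div d), int b, 0, int d)) x) = x"
      using x by simp
    have "int (n div d) * int d = int n" using x by (simp flip: of_nat_mult)
    then show "(\<lambda>(d, b). (int (n div d), int b, 0, int d)) x \<in> hnf (int n)"
      using x by (auto simp: hnf_def)
    show "slash k f ((\<lambda>(d, b). (int (n div d), int b, 0, int d)) x) z =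
       (\<lambda>(d, b). 1 / complex_of_nat d ^ k * f ((complex_of_nat (n div d) * z + complex_of_nat b) / complex_of_nat d)) x"
      using x by simp
  qed
  finally show ?thesis by (simp add: classical_hecke_def)
qed

text \<open>Right multiplication by G permutes the left orbits of determinant n matrices, and each
  summand depends only on its orbit, so the sum over representatives is unchanged.\<close>

lemma classical_hecke_modular:
  assumes f: "f \<in> cusp_forms k" and n: "n > 0" and det: "p * s - q * r = 1" and z: "Im z > 0"
  shows "classical_hecke k n f ((of_int p * z + of_int q) / (of_int r * z + of_int s)) =
    (of_int r * z + of_int s) ^ k * classical_hecke k n f z"
proof -
  define G where "G = (p, q, r, s)"
  define j where "j = of_int r * z + of_int s"
  have G: "mdet G = 1" using det by (simp add: G_def)
  have j: "j \<noteq> 0" using moebius_Im(1)[OF z, of p s q r] det by (simp add: j_def)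
  have detR: "mdet M = int n" if "M \<in> hnf (int n)" for M
    using that by (auto simp: hnf_def)
  have "\<forall>M\<in>hnf (int n). \<exists>H. mdet H = 1 \<and> mmul H (mmul M G) \<in> hnf (int n)"
  proof
    fix M assume "M \<in> hnf (int n)"
    then have "mdet (mmul M G) = int n" by (simp add: mdet_mmul G detR)
    then show "\<exists>H. mdet H = 1 \<and> mmul H (mmul M G) \<in> hnf (int n)"
      using exists_hnf[of "mmul M G"] n by (metis of_nat_0_less_iff)
  qed
  then obtain H where H: "\<And>M. M \<in> hnf (int n) \<Longrightarrow> mdet (H M) = 1"
      "\<And>M. M \<in> hnf (int n) \<Longrightarrow> mmul (H M) (mmul M G) \<in> hnf (int n)"
    by metis
  \<comment> \<open>The normal form representing the orbit of M G.\<close>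
  define \<rho> where "\<rho> M = mmul (H M) (mmul M G)" for M
  have inj: "inj_on \<rho> (hnf (int n))"
  proof (rule inj_onI)
    fix M M' assume M: "M \<in> hnf (int n)" "M' \<in> hnf (int n)" and eq: "\<rho> M = \<rho> M'"
    have "mmul (mmul (H M) M) G = mmul (mmul (H M') M') G"
      using eq by (simp add: \<rho>_def mmul_assoc)
    then have "mmul (H M) M = mmul (H M') M'"
      using mmul_adj_right[OF G] by metis
    then have "mmul (mmul (adj (H M')) (H M)) M = M'"
      using mmul_adj_left[OF H(1)[OF M(2)]] by (metis mmul_assoc)
    moreover have "mdet (mmul (adj (H M')) (H M)) = 1"
      using H(1) M by (simp add: mdet_mmul mdet_adj)
    ultimately show "M = M'"
      using hnf_unique[OF _ M] n by simp
  qed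
  \<comment> \<open>Surjectivity comes from finiteness: an injective self-map of a finite set is
    onto.\<close>
  have "\<rho> ` hnf (int n) = hnf (int n)"
    using inj H(2) finite_hnf[of "int n"] n by (intro endo_inj_surj) (auto simp: \<rho>_def)
  then have bij: "bij_betw \<rho> (hnf (int n)) (hnf (int n))"
    using inj by (simp add: bij_betw_def)
  have "(\<Sum>M\<in>hnf (int n). slash k f M ((of_int p * z + of_int q) / j)) / j ^ k =
      (\<Sum>M\<in>hnf (int n). slash k f (mmul M G) z)"
    using slash_mmul_right[OF G[unfolded G_def] z] by (simp add: G_def j_def sum_divide_distrib)
  also have "\<dots> = (\<Sum>M\<in>hnf (int n). slash k f (\<rho> M) z)"
    using n by (intro sum.cong refl)
      (simp add: \<rho>_def slash_SL2_left[OF f H(1)] z mdet_mmul G detR)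
  also have "\<dots> = (\<Sum>M\<in>hnf (int n). slash k f M z)"
    by (rule sum.reindex_bij_betw[OF bij])
  finally have "(\<Sum>M\<in>hnf (int n). slash k f M ((of_int p * z + of_int q) / j)) =
      j ^ k * (\<Sum>M\<in>hnf (int n). slash k f M z)"
    using j by (simp add: field_simps)
  then show ?thesis
    by (simp add: classical_hecke_eq_sum_slash[OF n] j_def[symmetric])
qed

lemma hecke_coeff_0: "\<alpha> 0 = 0 \<Longrightarrow> hecke_coeff k n \<alpha> 0 = 0"
  by (simp add: hecke_coeff_def)

lemma classical_hecke_in_cusp_forms:
  assumes f: "f \<in> cusp_forms k" and n: "n > 0"
  shows "classical_hecke k n f \<in> cusp_forms k"
proof -
  obtain \<alpha> where \<alpha>: "\<alpha> 0 = 0" "has_qexp \<alpha> f" using cusp_form_qexp[OF f] .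
  have Im: "Im ((of_nat (n div d) * z + of_nat b) / of_nat d) = real (n div d) * Im z / real d" for d b z
    by (simp add: Im_divide_of_nat)
  have pos: "real (n div d) > 0 \<and> real d > 0" if "d dvd n" for d
    using that n by (auto intro: dvd_pos_nat simp: div_greater_zero_iff dvd_imp_le)
  have "classical_hecke k n f holomorphic_on upper_half_plane"
    unfolding classical_hecke_def
  proof (intro holomorphic_intros)
    fix d b assume d: "d \<in> {d. d dvd n}" "b \<in> {..<d}"
    have "(f \<circ> (\<lambda>z. (of_nat (n div d) * z + of_nat b) / of_nat d)) holomorphic_on upper_half_plane"
    proof (rule holomorphic_on_compose_gen)
      show "f holomorphic_on upper_half_plane" using f by (simp add: cusp_forms_def)
      show "(\<lambda>z. (of_nat (n div d) * z + of_nat b) / of_nat d) holomorphic_on upper_half_plane"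
        using pos[of d] d by (intro holomorphic_intros) auto
      show "(\<lambda>z. (of_nat (n div d) * z + of_nat b) / of_nat d) ` upper_half_plane \<subseteq> upper_half_plane"
        using pos[of d] d by (auto simp: upper_half_plane_def Im)
    qed
    then show "(\<lambda>z. f ((of_nat (n div d) * z + of_nat b) / of_nat d)) holomorphic_on upper_half_plane"
      by (simp add: o_def)
  qed
  moreover have "classical_hecke k n f z = 0" if "z \<notin> upper_half_plane" for z
  proof -
    \<comment> \<open>The affine substitutions keep the sign of the imaginary part, so points
      outside the half plane stay outside, where f is zero by convention.\<close>
    have "f ((of_nat (n div d) * z + of_nat b) / of_nat d) = 0" if "d dvd n" for d b
    proof -
      have "\<not> Im ((of_nat (n div d) * z + of_nat b) / of_nat d) > 0"
        unfolding Im using \<open>z \<notin> _\<close> pos[OF that]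
        by (auto simp: upper_half_plane_def zero_less_mult_iff zero_less_divide_iff)
      then show ?thesis using f by (auto simp: cusp_forms_def upper_half_plane_def)
    qed
    then show ?thesis by (simp add: classical_hecke_def)
  qed
  moreover have "\<exists>\<beta>. \<beta> 0 = 0 \<and> (\<forall>z\<in>upper_half_plane.
      (\<lambda>m. \<beta> m * exp (2 * of_real pi * \<i> * of_nat m * z)) sums classical_hecke k n f z)"
  proof (intro exI conjI)
    show "hecke_coeff k n \<alpha> 0 = 0" by (rule hecke_coeff_0) (rule \<alpha>)
    show "\<forall>z\<in>upper_half_plane.
      (\<lambda>m. hecke_coeff k n \<alpha> m * exp (2 * of_real pi * \<i> * of_nat m * z)) sums classical_hecke k n f z"
      using has_qexp_classical_hecke[OF \<alpha>(2) n] unfolding has_qexp_def .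
  qed
  moreover have "classical_hecke k n f ((of_int p * z + of_int q) / (of_int r * z + of_int s)) =
    (of_int r * z + of_int s) ^ k * classical_hecke k n f z"
    if "p * s - q * r = 1" "z \<in> upper_half_plane" for p q r s z
    using classical_hecke_modular[OF f n that(1)] that(2) by (simp add: upper_half_plane_def)
  ultimately show ?thesis
    unfolding cusp_forms_def by blast
qed

subsection \<open>Sums of Hecke traces\<close>

text \<open>Substitute a = n/d. The sum runs over divisors of m, with divisibility of n as a
  condition, so that for fixed m the index set does not vary with n and sums over n can be moved
  inside.\<close>

lemma hecke_coeff_eq:
  assumes "n > 0" "m > 0" "k \<ge> 1"
  shows "hecke_coeff k n \<alpha> m =
    (\<Sum>a | a dvd m. if a dvd n then of_nat a ^ (k - 1) * \<alpha> (m div a * (n div a)) else 0)"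
proof -
  have "hecke_coeff k n \<alpha> m = (\<Sum>a | a dvd n. of_nat a ^ (k - 1) *
      (if a dvd m then \<alpha> (n div a * (m div a)) else 0))"
    unfolding hecke_coeff_def
  proof (rule sum.reindex_bij_witness[of _ "\<lambda>a. n div a" "\<lambda>d. n div d"])
    fix d assume "d \<in> {d. d dvd n}"
    then obtain a where a: "n = d * a" by auto
    then have pos: "a > 0" "d > 0" using assms by auto
    have "(of_nat n :: complex) ^ (k - 1) * of_nat d / of_nat d ^ k = of_nat a ^ (k - 1)"
      using pos assms(3) by (cases k) (auto simp: a power_mult_distrib)
    then show "of_nat (n div d) ^ (k - 1) *
        (if n div d dvd m then \<alpha> (n div (n div d) * (m div (n div d))) else 0) =
      of_nat n ^ (k - 1) * of_nat d / of_nat d ^ k *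
        (if n div d dvd m then \<alpha> (d * (m div (n div d))) else 0)"
      using pos by (simp add: a)
  qed (use assms in auto)
  also have "\<dots> = (\<Sum>a\<in>{a \<in> {a. a dvd n}. a dvd m}. of_nat a ^ (k - 1) * \<alpha> (n div a * (m div a)))"
    using assms by (subst sum.inter_filter) (auto intro!: sum.cong)
  also have "{a \<in> {a. a dvd n}. a dvd m} = {a \<in> {a. a dvd m}. a dvd n}" by auto
  also have "(\<Sum>a\<in>\<dots>. of_nat a ^ (k - 1) * \<alpha> (n div a * (m div a))) =
     (\<Sum>a | a dvd m. if a dvd n then of_nat a ^ (k - 1) * \<alpha> (n div a * (m div a)) else 0)"
    using assms by (subst sum.inter_filter) auto
  finally show ?thesis by (simp only: mult.commute[of "n div _"])
qed

lemma sum_multiples: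
  fixes g :: "nat \<Rightarrow> 'a::comm_monoid_add"
  assumes "a > 0"
  shows "(\<Sum>n=1..N. if a dvd n then g (n div a) else 0) = (\<Sum>d=1..N div a. g d)"
proof -
  have "(\<Sum>n=1..N. if a dvd n then g (n div a) else 0) = (\<Sum>n\<in>{n\<in>{1..N}. a dvd n}. g (n div a))"
    by (rule sum.inter_filter[symmetric]) simp
  also have "\<dots> = (\<Sum>d=1..N div a. g d)"
    using assms by (intro sum.reindex_bij_witness[of _ "\<lambda>d. a * d" "\<lambda>n. n div a"])
      (auto simp: less_eq_div_iff_mult_less_eq mult.commute div_le_mono elim!: dvdE)
  finally show ?thesis .
qed

text \<open>The coefficients at multiples of r belong to the average of the shifts (z + b)/r. These
  have height Im z / r, so the growth bound survives with an extra constant r^s, and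
  \<open>qexp_coeff_sum_bound\<close> asks for no more than growth.\<close>

lemma cusp_form_coeff_multiples_sum_bound:
  assumes f: "f \<in> cusp_forms k" and k: "k \<ge> 1" and \<alpha>: "has_qexp \<alpha> f" and r: "r > 0"
  obtains D where "\<And>N. N \<ge> 1 \<Longrightarrow>
    norm (\<Sum>n=1..N. \<alpha> (r * n)) \<le> D * (real N powr (real k / 2) * ln (real N + 1))"
proof -
  define s where "s = real k / 2"
  obtain C where C: "\<And>z. Im z > 0 \<Longrightarrow> norm (f z) \<le> C * Im z powr (- s)"
    using cusp_form_growth[OF f k] unfolding s_def by metis
  have "norm ((\<Sum>b<r. f ((z + of_nat b) / of_nat r)) / of_nat r) \<le> (C * real r powr s) * Im z powr (- s)"
    if z: "Im z > 0" for z
  proof -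
    have "norm (\<Sum>b<r. f ((z + of_nat b) / of_nat r)) \<le> of_nat (card {..<r}) * (C * real r powr s * Im z powr (- s))"
    proof (rule sum_norm_bound)
      fix b
      have Im: "Im ((z + of_nat b) / of_nat r) = Im z / real r" by (simp add: Im_divide_of_nat)
      have "norm (f ((z + of_nat b) / of_nat r)) \<le> C * (Im z / real r) powr (- s)"
        using C[of "(z + of_nat b) / of_nat r"] z r unfolding Im by simp
      also have "(Im z / real r) powr (- s) = real r powr s * Im z powr (- s)"
        using z r by (simp add: powr_divide powr_minus_divide)
      finally show "norm (f ((z + of_nat b) / of_nat r)) \<le> C * real r powr s * Im z powr (- s)"
        by (simp add: mult.assoc)
    qed
    then show ?thesis using r by (simp add: norm_divide divide_le_eq mult_ac)
  qed
  from qexp_coeff_sum_bound[OF has_qexp_average_shifts[OF \<alpha> r] this] that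
  show ?thesis unfolding s_def by metis
qed

text \<open>For each of the finitely many divisors a of m, the terms n = a d contribute a^(k-1)
  times a sum of coefficients at multiples of m/a, with d up to N/a.\<close>

lemma hecke_coeff_sum_bound:
  assumes f: "f \<in> cusp_forms k" and k: "k \<ge> 1" and \<alpha>: "has_qexp \<alpha> f" "\<alpha> 0 = 0"
  obtains D where "\<And>N. N \<ge> 1 \<Longrightarrow>
    norm (\<Sum>n=1..N. hecke_coeff k n \<alpha> m) \<le> D * (real N powr (real k / 2) * ln (real N + 1))"
proof (cases "m = 0")
  case True
  then show ?thesis using that[of 0] hecke_coeff_0[of \<alpha>, OF \<alpha>(2)] by simp
next
  case False
  define h where "h N = real N powr (real k / 2) * ln (real N + 1)" for N
  have h_mono: "h M \<le> h N" if "M \<le> N" for M N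
    unfolding h_def using that by (intro mult_mono powr_mono2) auto
  have "\<exists>D. \<forall>N\<ge>1. norm (\<Sum>n=1..N. \<alpha> (r * n)) \<le> D * h N" if "r > 0" for r
    using cusp_form_coeff_multiples_sum_bound[OF f k \<alpha>(1) that] unfolding h_def by metis
  then obtain D where D: "\<And>r N. r > 0 \<Longrightarrow> N \<ge> 1 \<Longrightarrow> norm (\<Sum>n=1..N. \<alpha> (r * n)) \<le> D r * h N"
    by metis
  \<comment> \<open>The range N div a may be empty and the sign of \<open>D r\<close> is not known;
    the absolute value and the monotonicity of \<open>h\<close> handle both.\<close>
  have D': "norm (\<Sum>n=1..M. \<alpha> (r * n)) \<le> \<bar>D r\<bar> * h N" if "r > 0" "M \<le> N" for r M N
  proof (cases "M \<ge> 1")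
    case True
    have "norm (\<Sum>n=1..M. \<alpha> (r * n)) \<le> D r * h M" using D that True by blast
    also have "\<dots> \<le> \<bar>D r\<bar> * h N"
      using h_mono[OF that(2)] by (intro mult_mono) (auto simp: h_def)
    finally show ?thesis .
  qed (auto simp: h_def)
  have "norm (\<Sum>n=1..N. hecke_coeff k n \<alpha> m) \<le> (\<Sum>a | a dvd m. real a ^ (k - 1) * \<bar>D (m div a)\<bar>) * h N" for N
  proof -
    have "(\<Sum>n=1..N. hecke_coeff k n \<alpha> m) = (\<Sum>n=1..N. \<Sum>a | a dvd m. 
        if a dvd n then of_nat a ^ (k - 1) * \<alpha> (m div a * (n div a)) else 0)"
      using False k by (intro sum.cong refl hecke_coeff_eq) auto
    also have "\<dots> = (\<Sum>a | a dvd m. \<Sum>n=1..N.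
        if a dvd n then of_nat a ^ (k - 1) * \<alpha> (m div a * (n div a)) else 0)"
      by (rule sum.swap)
    also have "\<dots> = (\<Sum>a | a dvd m. of_nat a ^ (k - 1) * (\<Sum>d=1..N div a. \<alpha> (m div a * d)))"
      unfolding sum_distrib_left using False
      by (intro sum.cong refl sum_multiples) (auto intro: dvd_pos_nat)
    also have "norm \<dots> \<le> (\<Sum>a | a dvd m. real a ^ (k - 1) * \<bar>D (m div a)\<bar> * h N)"
    proof (rule sum_norm_le)
      fix a assume "a \<in> {a. a dvd m}"
      then have "m div a > 0" using False by (auto simp: div_greater_zero_iff dvd_imp_le intro: dvd_pos_nat)
      from D'[OF this, of "N div a" N]
      show "norm (of_nat a ^ (k - 1) * (\<Sum>d=1..N div a. \<alpha> (m div a * d))) \<le> real a ^ (k - 1) * \<bar>D (m div a)\<bar> * h N"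
        by (simp add: norm_mult norm_power mult.assoc mult_left_mono)
    qed
    finally show ?thesis by (simp add: sum_distrib_right)
  qed
  then show ?thesis using that unfolding h_def by blast
qed

section \<open>Summation by parts and dual functionals\<close>

lemma powr_neg_diff_le:
  fixes x p :: real
  assumes "x > 0" "p \<ge> 0"
  shows "\<bar>x powr (- p) - (x + 1) powr (- p)\<bar> \<le> p * x powr (- p - 1)"
proof -
  have "(x + 1) powr (- p) \<le> x powr (- p)"
    using assms by (intro powr_mono2') auto
  moreover have "x powr (- p) - p * x powr (- p - 1) \<le> (x + 1) powr (- p)"
  proof -
    \<comment> \<open>Bernoulli's inequality (1 + 1/x)^(-p) >= 1 - p/x, scaled by x^(-p).\<close>
    have "ln (1 + 1 / x) \<le> 1 / x" using assms by (intro ln_add_one_self_le_self) auto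
    then have "p * ln (1 + 1 / x) \<le> p * (1 / x)" using assms by (intro mult_left_mono)
    then have "1 - p / x \<le> 1 + - p * ln (1 + 1 / x)" by simp
    also have "\<dots> \<le> exp (- p * ln (1 + 1 / x))" by (rule exp_ge_add_one_self)
    also have "\<dots> = (1 + 1 / x) powr (- p)"
      using assms add_pos_pos[of 1 "1 / x"] by (simp add: powr_def)
    finally have "x powr (- p) * (1 - p / x) \<le> x powr (- p) * (1 + 1 / x) powr (- p)"
      by (intro mult_left_mono) auto
    also have "\<dots> = (x * (1 + 1 / x)) powr (- p)" using assms by (simp add: powr_mult add_pos_pos)
    also have "x * (1 + 1 / x) = x + 1" using assms by (simp add: field_simps)
    also have "x powr (- p) * (1 - p / x) = x powr (- p) - p * x powr (- p - 1)"
      using assms by (simp add: powr_diff right_diff_distrib)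
    finally show ?thesis .
  qed
  ultimately show ?thesis by simp
qed

lemma weighted_sum_bound:
  fixes c :: "nat \<Rightarrow> complex"
  assumes p: "p \<ge> 0"
    and bd: "\<And>N. N \<ge> 1 \<Longrightarrow> norm (\<Sum>n=1..N. c n) \<le> D * (real N powr (p + 1 / 2) * ln (real N + 1))"
    and N: "N \<ge> 1"
  shows "norm (\<Sum>n=1..N. of_real (real n powr (- p)) * c n) \<le> D * (1 + 3 * p) * (sqrt N * ln (real N + 1))"
proof -
  define w :: "nat \<Rightarrow> complex" where "w n = of_real (real n powr (- p))" for n
  define G where "G n = (\<Sum>n=1..n. c n)" for n
  \<comment> \<open>Abel summation as a recursion: \<open>R\<close> is the weighted sum without its
    boundary term. The boundary term accounts for the 1 in 1 + 3p, and \<open>R\<close> for the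
    3p.\<close>
  define R where "R n = (\<Sum>n=1..n. w n * c n) - w n * G n" for n
  have "0 \<le> D * ln 2" using bd[of 1] by (simp add: order_trans[OF norm_ge_zero])
  then have D: "D \<ge> 0" by (simp add: zero_le_mult_iff)
  have R_Suc: "R (Suc n) = R n + (w n - w (Suc n)) * G n" for n
    by (simp add: R_def G_def algebra_simps)
  have "norm (R n) \<le> 3 * p * D * (sqrt n * ln (real n + 1))" if "n \<ge> 1" for n
    using that
  proof (induction n rule: dec_induct)
    case base
    show ?case using p D by (simp add: R_def G_def)
  next
    case (step n)
    have n: "real n > 0" using step by simp
    have "norm ((w n - w (Suc n)) * G n) \<le> (p * real n powr (- p - 1)) * (D * (real n powr (p + 1 / 2) * ln (real n + 1)))"
      unfolding norm_mult
    proof (rule mult_mono)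
      show "norm (w n - w (Suc n)) \<le> p * real n powr (- p - 1)"
        using powr_neg_diff_le[OF n p] unfolding w_def of_real_diff[symmetric] norm_of_real
        by (simp add: add.commute)
      show "norm (G n) \<le> D * (real n powr (p + 1 / 2) * ln (real n + 1))"
        unfolding G_def by (rule bd) fact
    qed (use p in auto)
    also have "\<dots> = p * D * ((real n powr (- p - 1) * real n powr (p + 1 / 2)) * ln (real n + 1))"
      by (simp add: mult_ac)
    also have "real n powr (- p - 1) * real n powr (p + 1 / 2) = 1 / sqrt n"
      using n by (simp add: powr_add[symmetric] powr_minus_divide powr_half_sqrt)
    finally have *: "norm ((w n - w (Suc n)) * G n) \<le> p * D * (1 / sqrt n * ln (real n + 1))" .
    have "norm (R (Suc n)) \<le> 3 * p * D * (sqrt n * ln (real n + 1)) + p * D * (1 / sqrt n * ln (real n + 1))"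
      unfolding R_Suc using norm_triangle_le[OF add_mono[OF step.IH *]] .
    also have "\<dots> = p * D * ((3 * sqrt n + 1 / sqrt n) * ln (real n + 1))"
      by (simp add: algebra_simps)
    also have "\<dots> \<le> p * D * ((3 * sqrt (Suc n)) * ln (real (Suc n) + 1))"
    proof (intro mult_left_mono mult_mono)
      \<comment> \<open>The growth per step is paid for by 1/sqrt n <= 3 (sqrt (n+1) - sqrt n),
        which follows from (b - a)(b + a) = 1 and b <= 2a.\<close>
      define a b where "a = sqrt n" and "b = sqrt (Suc n)"
      have ab: "a > 0" "b > 0" "b\<^sup>2 = a\<^sup>2 + 1" using n by (auto simp: a_def b_def)
      have "a \<ge> 1" using step by (simp add: a_def)
      then have "1 \<le> a\<^sup>2" by simp
      then have "b\<^sup>2 \<le> (2 * a)\<^sup>2" using ab(3) by (simp add: power_mult_distrib)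
      then have "b \<le> 2 * a" using ab by (intro power2_le_imp_le[of b "2 * a"]) auto
      have "(b - a) * (b + a) = 1" using ab by (simp add: power2_eq_square algebra_simps)
      moreover have "(b - a) * (b + a) \<le> (b - a) * (3 * a)"
        using \<open>b \<le> 2 * a\<close> by (intro mult_left_mono) (auto simp: a_def b_def)
      ultimately have "1 / a \<le> 3 * (b - a)" using ab by (simp add: field_simps)
      then show "3 * sqrt n + 1 / sqrt n \<le> 3 * sqrt (Suc n)" by (simp add: a_def b_def)
    qed (use p D n in auto)
    finally show ?case by (simp add: mult_ac)
  qed
  then have R: "norm (R N) \<le> 3 * p * D * (sqrt N * ln (real N + 1))" using N by blast
  have "norm (w N * G N) \<le> real N powr (- p) * (D * (real N powr (p + 1 / 2) * ln (real N + 1)))"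
    unfolding norm_mult G_def using bd[OF N] by (intro mult_mono) (auto simp: w_def)
  also have "\<dots> = D * ((real N powr (- p) * real N powr (p + 1 / 2)) * ln (real N + 1))"
    by (simp add: mult_ac)
  also have "real N powr (- p) * real N powr (p + 1 / 2) = sqrt N"
    using N by (simp add: powr_add[symmetric] powr_half_sqrt)
  finally have "norm (R N + w N * G N) \<le> 3 * p * D * (sqrt N * ln (real N + 1)) + D * (sqrt N * ln (real N + 1))"
    using norm_triangle_le[OF add_mono[OF R]] by blast
  then show ?thesis by (simp add: R_def w_def algebra_simps)
qed

text \<open>Finitely many linearly independent sequences are already separated by finitely many
  entries. The induction is a Gram-Schmidt process on the functionals; it later writes basis
  coordinates as combinations of Fourier coefficients.\<close>

lemma dual_family_exists:
  fixes a :: "'b \<Rightarrow> nat \<Rightarrow> 'c::field"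
  assumes "finite B"
    and "\<And>x. (\<And>m. (\<Sum>b\<in>B. x b * a b m) = 0) \<Longrightarrow> \<forall>b\<in>B. x b = 0"
  shows "\<exists>M c. \<forall>b\<in>B. \<forall>b'\<in>B. (\<Sum>m<M. c b m * a b' m) = (if b = b' then 1 else 0)"
  using assms
proof (induction B rule: finite_induct)
  case empty
  then show ?case by simp
next
  case (insert e B)
  have "\<forall>b\<in>B. x b = 0" if x: "\<And>m. (\<Sum>b\<in>B. x b * a b m) = 0" for x
  proof -
    have "(\<Sum>b\<in>insert e B. (x(e := 0)) b * a b m) = 0" for m
    proof -
      have "(\<Sum>b\<in>B. (x(e := 0)) b * a b m) = (\<Sum>b\<in>B. x b * a b m)"
        using insert.hyps by (intro sum.cong) auto
      then show ?thesis using insert.hyps x by simp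
    qed
    from insert.prems[OF this] show ?thesis using insert.hyps(2) by (metis fun_upd_other insertCI)
  qed
  from insert.IH[OF this] obtain M c where
    c: "\<And>b b'. b \<in> B \<Longrightarrow> b' \<in> B \<Longrightarrow> (\<Sum>m<M. c b m * a b' m) = (if b = b' then 1 else 0)" by blast
  define \<phi> where "\<phi> b b' = (\<Sum>m<M. c b m * a b' m)" for b b'
  have \<phi>: "\<phi> b b' = (if b = b' then 1 else 0)" if "b \<in> B" "b' \<in> B" for b b'
    using c that by (simp add: \<phi>_def)
  \<comment> \<open>What remains of e after removing its B-part, as measured by the functionals
    found so far, has a nonzero entry; otherwise e would give a linear dependence.\<close>
  obtain l where l: "a e l - (\<Sum>b\<in>B. \<phi> b e * a b l) \<noteq> 0"
  proof (rule ccontr)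
    assume "\<not> thesis"
    then have *: "a e m - (\<Sum>b\<in>B. \<phi> b e * a b m) = 0" for m using that by blast
    define x where "x b = (if b = e then 1 else - \<phi> b e)" for b
    have "(\<Sum>b\<in>insert e B. x b * a b m) = 0" for m
    proof -
      have "(\<Sum>b\<in>B. x b * a b m) = (\<Sum>b\<in>B. - (\<phi> b e * a b m))"
        using insert.hyps by (intro sum.cong) (auto simp: x_def)
      then show ?thesis using insert.hyps *[of m] by (simp add: x_def sum_negf)
    qed
    from insert.prems[OF this] show False by (simp add: x_def)
  qed
  define \<delta> where "\<delta> = a e l - (\<Sum>b\<in>B. \<phi> b e * a b l)"
  define K where "K = max M (Suc l)"
  define c0 where "c0 b m = (if m < M then c b m else 0)" for b m
  have sum_c0: "(\<Sum>m<K. c0 b m * a b' m) = \<phi> b b'" for b b'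
  proof -
    have "(\<Sum>m<K. c0 b m * a b' m) = (\<Sum>m<M. c0 b m * a b' m)"
      by (rule sum.mono_neutral_right) (auto simp: K_def c0_def)
    then show ?thesis by (simp add: c0_def \<phi>_def)
  qed
  \<comment> \<open>Reads off entry l of that remainder, divided by its value at e: it vanishes on B
    and equals 1 on e.\<close>
  define ce where "ce m = ((if m = l then 1 else 0) - (\<Sum>b\<in>B. a b l * c0 b m)) / \<delta>" for m
  define \<psi> where "\<psi> b' = (\<Sum>m<K. ce m * a b' m)" for b'
  have \<psi>: "\<psi> b' = (a b' l - (\<Sum>b\<in>B. a b l * \<phi> b b')) / \<delta>" for b'
  proof -
    have "\<psi> b' = ((\<Sum>m<K. (if m = l then a b' m else 0)) - (\<Sum>m<K. \<Sum>b\<in>B. a b l * (c0 b m * a b' m))) / \<delta>"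
      unfolding \<psi>_def ce_def sum_subtractf[symmetric] sum_divide_distrib
      by (intro sum.cong refl) (simp add: left_diff_distrib sum_distrib_right mult.assoc)
    also have "(\<Sum>m<K. \<Sum>b\<in>B. a b l * (c0 b m * a b' m)) = (\<Sum>b\<in>B. a b l * \<phi> b b')"
      by (subst sum.swap) (simp add: sum_distrib_left[symmetric] sum_c0)
    finally show ?thesis by (simp add: K_def)
  qed
  have \<psi>B: "\<psi> b' = 0" if "b' \<in> B" for b'
  proof -
    have "(\<Sum>b\<in>B. a b l * \<phi> b b') = (\<Sum>b\<in>B. if b = b' then a b l else 0)"
      using that by (intro sum.cong) (auto simp: \<phi>)
    then show ?thesis using that insert.hyps by (simp add: \<psi>)
  qed
  have \<psi>e: "\<psi> e = 1" using l by (simp add: \<psi> \<delta>_def mult.commute)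
  \<comment> \<open>The old functionals, padded with zeros to length \<open>K\<close>, are corrected
    by a multiple of \<open>ce\<close> so that they vanish on e.\<close>
  define c' where "c' b m = (if b = e then ce m else c0 b m - \<phi> b e * ce m)" for b m
  have c'e: "(\<Sum>m<K. c' e m * a b' m) = \<psi> b'" for b'
    by (simp add: c'_def \<psi>_def)
  have c'B: "(\<Sum>m<K. c' b m * a b' m) = \<phi> b b' - \<phi> b e * \<psi> b'" if "b \<in> B" for b b'
  proof -
    have "b \<noteq> e" using that insert.hyps by auto
    then show ?thesis
      by (simp add: c'_def left_diff_distrib sum_subtractf sum_c0 \<psi>_def sum_distrib_left mult.assoc)
  qed
  have "(\<Sum>m<K. c' b m * a b' m) = (if b = b' then 1 else 0)"
    if "b \<in> insert e B" "b' \<in> insert e B" for b b'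
    using that insert.hyps by (auto simp: c'e c'B \<psi>B \<psi>e \<phi>)
  then show ?case by blast
qed

section \<open>From traces to sums of Fourier coefficients\<close>

lemma hecke_in_cusp_forms:
  assumes "f \<in> cusp_forms k" "n > 0"
  shows "hecke k n f \<in> cusp_forms k"
  unfolding hecke_def
  using classical_hecke_in_cusp_forms[OF assms] subspace_cusp_forms cfun.subspace_scale by blast

lemma hecke_trace_sum_bound:
  assumes k: "k \<ge> 1"
  obtains E where "\<And>N. N \<ge> 1 \<Longrightarrow> norm (\<Sum>n=1..N. hecke_trace k n) \<le> E * (sqrt N * ln (real N + 1))"
proof -
  \<comment> \<open>The very choice made inside \<open>trace_on\<close>, so that the trace unfolds
    to a sum over this B.\<close>
  define B where "B = (SOME B. cfun.is_basis_of B (cusp_forms k))"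
  have "\<exists>B. cfun.is_basis_of B (cusp_forms k)"
    unfolding cfun.is_basis_of_def
    by (rule cfun.maximal_independent_subset[of "cusp_forms k"]) (intro exI conjI)
  then have "cfun.is_basis_of B (cusp_forms k)" unfolding B_def by (rule someI_ex)
  then have BS: "B \<subseteq> cusp_forms k" and ind: "cfun.independent B" and SB: "cusp_forms k \<subseteq> cfun.span B"
    by (auto simp: cfun.is_basis_of_def)
  have trace: "hecke_trace k n = (\<Sum>b\<in>B. cfun.representation B (hecke k n b) b)" for n
    by (simp add: hecke_trace_def cfun.trace_on_def B_def Let_def)
  show ?thesis
  proof (cases "finite B")
    case False \<comment> \<open>the sum over an infinite basis is \<open>0\<close> by convention\<close>
    then show ?thesis using that[of 0] by (simp add: trace)
  next
    case fin: True
    have "\<forall>b\<in>B. \<exists>\<alpha>. \<alpha> 0 = 0 \<and> has_qexp \<alpha> b" 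
    proof
      fix b assume "b \<in> B"
      then have "b \<in> cusp_forms k" using BS by blast
      then show "\<exists>\<alpha>. \<alpha> 0 = 0 \<and> has_qexp \<alpha> b" by (rule cusp_form_qexp) (intro exI conjI)
    qed
    then obtain a where "\<forall>b\<in>B. a b 0 = 0 \<and> has_qexp (a b) b" by (rule bchoice[THEN exE])
    then have a0: "a b 0 = 0" and a: "has_qexp (a b) b" if "b \<in> B" for b
      using that by auto
    have comb: "has_qexp (\<lambda>m. \<Sum>b\<in>B. x b * a b m) (\<Sum>b\<in>B. fun_scale (x b) b)" for x
    proof -
      have "has_qexp (\<lambda>m. \<Sum>b\<in>B. x b * a b m) (\<lambda>z. \<Sum>b\<in>B. x b * b z)"
        by (rule has_qexp_sum, rule has_qexp_cmult, rule a)
      also have "(\<lambda>z. \<Sum>b\<in>B. x b * b z) = (\<Sum>b\<in>B. fun_scale (x b) b)"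
        by (induction B rule: infinite_finite_induct) (auto simp: fun_eq_iff fun_scale_def)
      finally show ?thesis .
    qed
    have "\<exists>M c. \<forall>b\<in>B. \<forall>b'\<in>B. (\<Sum>m<M. c b m * a b' m) = (if b = b' then 1 else 0)"
    proof (rule dual_family_exists[OF fin])
      \<comment> \<open>A relation between the coefficient sequences gives a form with zero
        expansion; it also vanishes off the half plane, so independence of B applies.\<close>
      fix x assume x: "\<And>m. (\<Sum>b\<in>B. x b * a b m) = 0"
      define F where "F = (\<Sum>b\<in>B. fun_scale (x b) b)"
      have "F \<in> cusp_forms k"
        unfolding F_def using BS
        by (intro cfun.subspace_sum cfun.subspace_scale subspace_cusp_forms) auto
      then have "F z = 0" if "z \<notin> upper_half_plane" for z using that by (simp add: cusp_forms_def)
      moreover have "F z = 0" if "z \<in> upper_half_plane" for z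
      proof -
        have "has_qexp (\<lambda>m. 0) F" using comb[of x] by (simp add: x F_def)
        then have "(\<lambda>m. 0) sums F z" using that by (simp add: has_qexp_def)
        then show ?thesis using sums_unique2 sums_zero by blast
      qed
      ultimately have "F = 0" by (auto simp: fun_eq_iff zero_fun_def)
      then show "\<forall>b\<in>B. x b = 0"
        using cfun.independentD[OF ind fin subset_refl] unfolding F_def by blast
    qed
    then obtain M c where
      c: "\<And>b b'. b \<in> B \<Longrightarrow> b' \<in> B \<Longrightarrow> (\<Sum>m<M. c b m * a b' m) = (if b = b' then 1 else 0)" by blast
    define p where "p = (real k - 1) / 2"
    \<comment> \<open>The normalizing exponent is 1/2 below the exponent k/2 of Hecke's bound, so
      removing the weight leaves sqrt N.\<close>
    have p: "p \<ge> 0" "p + 1 / 2 = real k / 2" using k by (auto simp: p_def field_simps)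
    have rep: "cfun.representation B (hecke k n b) b =
        (\<Sum>m<M. c b m * (of_real (real n powr (- p)) * hecke_coeff k n (a b) m))"
      if b: "b \<in> B" and n: "n > 0" for b n
    proof -
      define r where "r = cfun.representation B (hecke k n b)"
      have "hecke k n b \<in> cfun.span B" using hecke_in_cusp_forms[OF _ n] b BS SB by blast
      then have "(\<Sum>b'\<in>B. fun_scale (r b') b') = hecke k n b"
        unfolding r_def using ind fin by (intro cfun.sum_representation_eq) auto
      \<comment> \<open>The image of b is expanded twice, through the basis and through
        \<open>hecke_coeff\<close>; uniqueness equates the two, and the dual functional of b
        extracts its diagonal entry.\<close>
      then have "has_qexp (\<lambda>m. \<Sum>b'\<in>B. r b' * a b' m) (hecke k n b)"
        using comb[of r] by simp
      moreover have "has_qexp (\<lambda>m. of_real (real n powr (- p)) * hecke_coeff k n (a b) m) (hecke k n b)"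
        unfolding hecke_def fun_scale_def p_def
        by (rule has_qexp_cmult[OF has_qexp_classical_hecke[OF a[OF b] n]])
      ultimately have eq: "(\<Sum>b'\<in>B. r b' * a b' m) = of_real (real n powr (- p)) * hecke_coeff k n (a b) m" for m
        by (rule fun_cong[OF has_qexp_unique])
      have "(\<Sum>m<M. c b m * (of_real (real n powr (- p)) * hecke_coeff k n (a b) m)) =
         (\<Sum>m<M. \<Sum>b'\<in>B. r b' * (c b m * a b' m))"
        unfolding eq[symmetric] by (simp add: sum_distrib_left mult_ac)
      also have "\<dots> = (\<Sum>b'\<in>B. r b' * (\<Sum>m<M. c b m * a b' m))"
        by (subst sum.swap) (simp add: sum_distrib_left)
      also have "\<dots> = (\<Sum>b'\<in>B. if b = b' then r b' else 0)"
        using b by (intro sum.cong) (auto simp: c)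
      also have "\<dots> = r b" using b fin by simp
      finally show ?thesis by (simp add: r_def)
    qed
    have "\<exists>D. \<forall>N\<ge>1. norm (\<Sum>n=1..N. hecke_coeff k n (a b) m) \<le> D * (real N powr (real k / 2) * ln (real N + 1))"
      if "b \<in> B" for b m
    proof -
      have "b \<in> cusp_forms k" using that BS by blast
      from hecke_coeff_sum_bound[OF this k a[OF that] a0[OF that], of m] show ?thesis by blast
    qed
    then obtain D where D: "\<And>b m N. b \<in> B \<Longrightarrow> N \<ge> 1 \<Longrightarrow>
        norm (\<Sum>n=1..N. hecke_coeff k n (a b) m) \<le> D b m * (real N powr (real k / 2) * ln (real N + 1))"
      by metis
    have "norm (\<Sum>n=1..N. hecke_trace k n) \<le>
        (\<Sum>b\<in>B. \<Sum>m<M. norm (c b m) * (D b m * (1 + 3 * p))) * (sqrt N * ln (real N + 1))" if N: "N \<ge> 1" for N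
    proof -
      have "(\<Sum>n=1..N. hecke_trace k n) =
          (\<Sum>n=1..N. \<Sum>b\<in>B. \<Sum>m<M. c b m * (of_real (real n powr (- p)) * hecke_coeff k n (a b) m))"
        unfolding trace by (intro sum.cong refl rep) auto
      also have "\<dots> = (\<Sum>b\<in>B. \<Sum>n=1..N. \<Sum>m<M. c b m * (of_real (real n powr (- p)) * hecke_coeff k n (a b) m))"
        by (rule sum.swap)
      also have "\<dots> = (\<Sum>b\<in>B. \<Sum>m<M. c b m * (\<Sum>n=1..N. of_real (real n powr (- p)) * hecke_coeff k n (a b) m))"
        unfolding sum_distrib_left by (intro sum.cong refl sum.swap)
      also have "norm \<dots> \<le> (\<Sum>b\<in>B. \<Sum>m<M. norm (c b m) * (D b m * (1 + 3 * p)) * (sqrt N * ln (real N + 1)))"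
      proof (intro sum_norm_le)
        fix b m assume "b \<in> B"
        then have "norm (\<Sum>n=1..N. of_real (real n powr (- p)) * hecke_coeff k n (a b) m) \<le>
            D b m * (1 + 3 * p) * (sqrt N * ln (real N + 1))"
          by (rule weighted_sum_bound[OF p(1), unfolded p(2), OF D N])
        then show "norm (c b m * (\<Sum>n=1..N. of_real (real n powr (- p)) * hecke_coeff k n (a b) m)) \<le>
            norm (c b m) * (D b m * (1 + 3 * p)) * (sqrt N * ln (real N + 1))"
          unfolding norm_mult mult.assoc by (intro mult_left_mono) (auto simp: mult.assoc)
      qed
      finally show ?thesis by (simp add: sum_distrib_right)
    qed
    then show ?thesis by (rule that)
  qed
qed

theorem theorem1p1:
  fixes k :: nat and \<epsilon> :: real
  assumes "k \<ge> 3" and "\<epsilon> > 0"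
  shows "(\<lambda>X::real. \<Sum>n | 1 \<le> n \<and> real n < X. hecke_trace k n)
           \<in> O[at_top](\<lambda>X. complex_of_real (X powr (31 / 32 + \<epsilon>)))"
proof -
  obtain E where E: "\<And>N. N \<ge> 1 \<Longrightarrow> norm (\<Sum>n=1..N. hecke_trace k n) \<le> E * (sqrt N * ln (real N + 1))"
    using hecke_trace_sum_bound[of k] assms by auto
  have "norm (\<Sum>n | 1 \<le> n \<and> real n < X. hecke_trace k n) \<le>
      (8 * \<bar>E\<bar>) * norm (complex_of_real (X powr (31 / 32 + \<epsilon>)))" if X: "X \<ge> 1" for X :: real
  proof -
    \<comment> \<open>The inequality n < X is strict, so the last index is the ceiling minus one; X
      = 1 gives the empty sum.\<close>
    define N where "N = nat (\<lceil>X\<rceil> - 1)"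
    have set: "{n. 1 \<le> n \<and> real n < X} = {1..N}"
      unfolding N_def by (auto simp: le_nat_iff less_ceiling_iff) linarith+
    have NX: "real N \<le> X" unfolding N_def using X by linarith
    have "norm (\<Sum>n=1..N. hecke_trace k n) \<le> \<bar>E\<bar> * (sqrt X * ln (X + 1))"
    proof (cases "N \<ge> 1")
      case True
      have "norm (\<Sum>n=1..N. hecke_trace k n) \<le> E * (sqrt N * ln (real N + 1))" by (rule E[OF True])
      also have "\<dots> \<le> \<bar>E\<bar> * (sqrt X * ln (X + 1))"
        using NX X by (intro mult_mono) auto
      finally show ?thesis .
    qed (use X in auto)
    also have "\<dots> \<le> \<bar>E\<bar> * (X powr (1 / 2) * (8 * X powr (1 / 4)))"
    proof (intro mult_left_mono mult_mono)
      show "sqrt X \<le> X powr (1 / 2)" using X by (simp add: powr_half_sqrt)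
      \<comment> \<open>Any exponent below 15/32 would do for the logarithm; 1/4 leads to X^(3/4).
        The constant 8 is 4 times a generous bound 2 for 2^(1/4), using X + 1 <= 2X.\<close>
      have "ln (X + 1) \<le> (X + 1) powr (1 / 4) / (1 / 4)" using X by (intro ln_powr_bound) auto
      also have "\<dots> \<le> 4 * (2 * X) powr (1 / 4)" using X by (simp add: powr_mono2)
      also have "\<dots> = 4 * (2 powr (1 / 4) * X powr (1 / 4))" using X by (simp add: powr_mult)
      also have "\<dots> \<le> 4 * (2 powr 1 * X powr (1 / 4))"
        by (intro mult_left_mono mult_right_mono powr_mono) auto
      finally show "ln (X + 1) \<le> 8 * X powr (1 / 4)" by simp
    qed (use X in auto)
    also have "\<dots> = (8 * \<bar>E\<bar>) * X powr (3 / 4)" using X by (simp add: powr_add[symmetric])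
    also have "\<dots> \<le> (8 * \<bar>E\<bar>) * X powr (31 / 32 + \<epsilon>)"
      using X assms by (intro mult_left_mono powr_mono) auto
    finally show ?thesis unfolding set by simp
  qed
  then show ?thesis
    by (intro bigoI[where c = "8 * \<bar>E\<bar>"] eventually_mono[OF eventually_ge_at_top[of 1]])
qed

end
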